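(* Let $r\ge2$. There is a residual set $\mathcal{R}\subset C^r(\mathbb{T}^2,\mathbb{R}^2)$ such that for all $\psi\in\mathcal{R}$, \[ \{x\in\mathbb{T}^2:\det D_x\psi=0\}\cap\{x\in\mathbb{T}^2:D_x(\det D\psi)=0\}=\emptyset , \] i.e. $0$ is a regular value of the function $x\mapsto\det D_x\psi$ on $\mathbb{T}^2$.
   Context: $\mathbb{T}=\mathbb{R}/\mathbb{Z}$. $D_x\psi$ is the derivative of $\psi$ at $x$, viewed as a $2\times2$ matrix, and $D_x(\det D\psi)$ is the derivative at $x$ of the scalar function $x\mapsto\det D_x\psi$. The space $C^r(\mathbb{T}^2,\mathbb{R}^2)$ has its usual $C^r$ topology. *)

theory Defs
  imports "HOL-Analysis.Analysis"
begin

section \<open>The torus\<close>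

quotient_type circle = real / "\<lambda>s t. s - t \<in> \<int>"
proof (rule equivpI)
  show "reflp (\<lambda>s t::real. s - t \<in> \<int>)" by (simp add: reflp_def)
  show "symp (\<lambda>s t::real. s - t \<in> \<int>)"
    by (metis (mono_tags, lifting) Ints_minus minus_diff_eq sympI)
  show "transp (\<lambda>s t::real. s - t \<in> \<int>)"
  proof (rule transpI)
    fix a b c :: real assume "a - b \<in> \<int>" "b - c \<in> \<int>"
    then have "(a - b) + (b - c) \<in> \<int>" by (rule Ints_add)
    then show "a - c \<in> \<int>" by simp
  qed
qed

type_synonym torus = "circle ^ 2"

definition proj :: "real ^ 2 \<Rightarrow> torus" where
  "proj v = (\<chi> i. abs_circle (v $ i))"

definition rep :: "torus \<Rightarrow> real ^ 2" where
  "rep x = (\<chi> i. rep_circle (x $ i))"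

text \<open>
  The smooth structure on the torus is the one for which the projection is a local
  diffeomorphism, so that differentiability of a map on the torus, and its derivatives in
  the standard coordinates, are those of its periodic lift to the plane.
\<close>

definition lift :: "(torus \<Rightarrow> 'b) \<Rightarrow> real ^ 2 \<Rightarrow> 'b" where
  "lift f = f \<circ> proj"

lemma proj_rep [simp]: "proj (rep x) = x"
  by (simp add: proj_def rep_def vec_eq_iff Quotient3_abs_rep[OF Quotient3_circle])

lemma proj_eq_iff: "proj v = proj w \<longleftrightarrow> (\<forall>i. v $ i - w $ i \<in> \<int>)"
  by (simp add: proj_def vec_eq_iff circle.abs_eq_iff)

lemma inj_lift: "lift f = lift g \<Longrightarrow> f = g"
  by (metis (no_types, lifting) comp_apply ext lift_def proj_rep)

section \<open>Derivatives\<close>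

definition tderiv :: "(torus \<Rightarrow> 'b::real_normed_vector) \<Rightarrow> torus \<Rightarrow> real ^ 2 \<Rightarrow> 'b" where
  "tderiv f x = frechet_derivative (lift f) (at (rep x))"

lemma frechet_derivative_shift:
  fixes F :: "'a::real_normed_vector \<Rightarrow> 'b::real_normed_vector"
  assumes "\<And>x. F (x + a) = F x"
  shows "frechet_derivative F (at (x + a)) = frechet_derivative F (at x)"
proof -
  have *: "(F has_derivative D) (at (x + a)) \<longleftrightarrow> (F has_derivative D) (at x)" for D
  proof
    assume "(F has_derivative D) (at (x + a))"
    then have "(F \<circ> (\<lambda>x. x + a) has_derivative D \<circ> (\<lambda>h. h)) (at x)"
      by (intro diff_chain_at) (auto intro!: derivative_eq_intros)
    then show "(F has_derivative D) (at x)" using assms by (simp add: o_def)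
  next
    assume D: "(F has_derivative D) (at x)"
    have "((\<lambda>y. y - a) has_derivative (\<lambda>h. h)) (at (x + a))"
      by (auto intro!: derivative_eq_intros)
    then have "(F \<circ> (\<lambda>y. y - a) has_derivative D \<circ> (\<lambda>h. h)) (at (x + a))"
      by (rule diff_chain_at) (use D in simp)
    moreover have "F (y - a) = F y" for y using assms[of "y - a"] by simp
    ultimately show "(F has_derivative D) (at (x + a))" by (simp add: o_def)
  qed
  then show ?thesis by (simp add: frechet_derivative_def)
qed

lemma lift_periodic:
  assumes "\<forall>i. a $ i \<in> \<int>" shows "lift f (v + a) = lift f v"
proof -
  have "proj (v + a) = proj v" using assms by (simp add: proj_eq_iff)
  then show ?thesis by (simp add: lift_def)
qed

text \<open>The choice of representative in \<open>rep\<close> is immaterial.\<close>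

lemma tderiv_proj: "tderiv f (proj v) = frechet_derivative (lift f) (at v)"
proof -
  define a where "a = rep (proj v) - v"
  have "proj (rep (proj v)) = proj v" by simp
  then have "\<forall>i. a $ i \<in> \<int>" unfolding proj_eq_iff by (simp add: a_def)
  then have "frechet_derivative (lift f) (at (v + a)) = frechet_derivative (lift f) (at v)"
    by (intro frechet_derivative_shift lift_periodic)
  then show ?thesis by (simp add: tderiv_def a_def)
qed

definition tjacobian :: "(torus \<Rightarrow> real ^ 2) \<Rightarrow> torus \<Rightarrow> real ^ 2 ^ 2" where
  "tjacobian f x = matrix (tderiv f x)"

definition regular_value :: "(torus \<Rightarrow> real) \<Rightarrow> real \<Rightarrow> bool" where
  "regular_value g c \<longleftrightarrow> (\<forall>x. g x = c \<longrightarrow> surj (tderiv g x))"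

section \<open>The space of \<open>C\<^sup>r\<close> maps\<close>

definition partial :: "2 \<Rightarrow> (real ^ 2 \<Rightarrow> 'b::real_normed_vector) \<Rightarrow> real ^ 2 \<Rightarrow> 'b" where
  "partial i F v = frechet_derivative F (at v) (axis i 1)"

definition partials :: "2 list \<Rightarrow> (real ^ 2 \<Rightarrow> 'b::real_normed_vector) \<Rightarrow> real ^ 2 \<Rightarrow> 'b" where
  "partials js F = foldr partial js F"

definition Cr_maps :: "nat \<Rightarrow> (torus \<Rightarrow> 'b::real_normed_vector) set" where
  "Cr_maps r = {f.
     (\<forall>js. length js < r \<longrightarrow> (\<forall>v. partials js (lift f) differentiable (at v))) \<and>
     (\<forall>js. length js \<le> r \<longrightarrow> continuous_on UNIV (partials js (lift f)))}"

text \<open>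
  The \<open>C\<^sup>r\<close> distance is the largest uniform distance between corresponding partial
  derivatives of order at most \<open>r\<close>. The supremum is finite on \<open>C\<^sup>r\<close> maps, by periodicity;
  the value 0 elsewhere only serves to make the function total and nonnegative.
\<close>

definition Cr_dist :: "nat \<Rightarrow> (torus \<Rightarrow> 'b::real_normed_vector) \<Rightarrow> (torus \<Rightarrow> 'b) \<Rightarrow> real" where
  "Cr_dist r f g =
     (if f \<in> Cr_maps r \<and> g \<in> Cr_maps r
      then SUP (js, v) \<in> {js. length js \<le> r} \<times> UNIV.
             norm (partials js (lift f) v - partials js (lift g) v)
      else 0)"

definition Cr_topology :: "nat \<Rightarrow> (torus \<Rightarrow> 'b::real_normed_vector) topology" where
  "Cr_topology r = Metric_space.mtopology (Cr_maps r) (Cr_dist r)"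

lemma partials_periodic:
  assumes a: "\<forall>i. a $ i \<in> \<int>"
  shows "partials js (lift f) (v + a) = partials js (lift f) v"
proof (induction js arbitrary: v)
  case Nil
  show ?case using lift_periodic[OF a] by (simp add: partials_def)
next
  case (Cons i js)
  then have "frechet_derivative (partials js (lift f)) (at (v + a)) =
      frechet_derivative (partials js (lift f)) (at v)"
    by (intro frechet_derivative_shift)
  then show ?case by (simp add: partials_def partial_def)
qed

lemma bounded_partials:
  assumes "f \<in> Cr_maps r" "length js \<le> r"
  shows "bounded (range (partials js (lift f)))"
proof -
  let ?F = "partials js (lift f)"
  have "continuous_on (cbox 0 1) ?F"
    by (rule continuous_on_subset[of UNIV]) (use assms in \<open>auto simp: Cr_maps_def\<close>)
  then have "bounded (?F ` cbox 0 1)"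
    by (intro compact_imp_bounded compact_continuous_image compact_cbox)
  moreover have "range ?F \<subseteq> ?F ` cbox 0 1"
  proof clarify
    fix v :: "real ^ 2"
    define a :: "real ^ 2" where "a = (\<chi> i. - of_int \<lfloor>v $ i\<rfloor>)"
    have "?F v = ?F (v + a)" by (rule partials_periodic[symmetric]) (simp add: a_def)
    moreover have "(v + a) $ i = frac (v $ i)" for i by (simp add: a_def frac_def)
    then have "v + a \<in> cbox 0 1" by (simp add: mem_box_cart less_imp_le frac_lt_1)
    ultimately show "?F v \<in> ?F ` cbox 0 1" by (rule image_eqI)
  qed
  ultimately show ?thesis by (rule bounded_subset)
qed

lemma bdd_above_Cr_dist:
  assumes "f \<in> Cr_maps r" "g \<in> Cr_maps r"
  shows "bdd_above ((\<lambda>(js, v). norm (partials js (lift f) v - partials js (lift g) v)) `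
           ({js. length js \<le> r} \<times> UNIV))"
proof -
  have "finite {js :: 2 list. length js \<le> r}"
    using finite_lists_length_le[of "UNIV :: 2 set" r] by simp
  moreover have "bdd_above ((\<lambda>(js, v). norm (partials js (lift f) v - partials js (lift g) v)) `
           ({js} \<times> UNIV))" if len: "length js \<le> r" for js
  proof -
    obtain A B where "\<And>v. norm (partials js (lift f) v) \<le> A" "\<And>v. norm (partials js (lift g) v) \<le> B"
      using bounded_partials[OF assms(1) len] bounded_partials[OF assms(2) len]
      unfolding bounded_iff by auto
    then have "norm (partials js (lift f) v - partials js (lift g) v) \<le> A + B" for v
      by (meson add_mono norm_triangle_ineq4 order_trans)
    then show ?thesis by (auto intro!: bdd_aboveI[where M = "A + B"])
  qed
  ultimately have "bdd_above (\<Union>js\<in>{js. length js \<le> r}.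
      (\<lambda>(js, v). norm (partials js (lift f) v - partials js (lift g) v)) ` ({js} \<times> UNIV))"
    by (subst bdd_above_UN) auto
  then show ?thesis by (rule bdd_above_mono) auto
qed

lemma Cr_dist_upper:
  assumes "f \<in> Cr_maps r" "g \<in> Cr_maps r" "length js \<le> r"
  shows "norm (partials js (lift f) v - partials js (lift g) v) \<le> Cr_dist r f g"
  using cSUP_upper[OF _ bdd_above_Cr_dist[OF assms(1,2)], of "(js, v)"] assms
  by (simp add: Cr_dist_def)

lemma Metric_space_Cr: "Metric_space (Cr_maps r) (Cr_dist r)"
proof
  show "0 \<le> Cr_dist r f g" for f g :: "torus \<Rightarrow> 'a"
  proof (cases "f \<in> Cr_maps r \<and> g \<in> Cr_maps r")
    case True
    then have "norm (partials [] (lift f) 0 - partials [] (lift g) 0) \<le> Cr_dist r f g"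
      by (intro Cr_dist_upper) auto
    then show ?thesis by (rule order_trans[OF norm_ge_zero])
  next
    case False
    then show ?thesis by (auto simp: Cr_dist_def)
  qed
  show "Cr_dist r f g = Cr_dist r g f" for f g :: "torus \<Rightarrow> 'a"
    unfolding Cr_dist_def
    by (subst conj_commute, subst norm_minus_commute) (rule refl)
  show "Cr_dist r f g = 0 \<longleftrightarrow> f = g" if "f \<in> Cr_maps r" "g \<in> Cr_maps r"
    for f g :: "torus \<Rightarrow> 'a"
  proof
    assume "Cr_dist r f g = 0"
    then have "lift f v = lift g v" for v
      using Cr_dist_upper[OF that, of "[]" v] by (simp add: partials_def)
    then show "f = g" by (intro inj_lift ext)
  next
    assume "f = g"
    then have "Cr_dist r f g =
        (SUP p \<in> {js :: 2 list. length js \<le> r} \<times> (UNIV :: (real ^ 2) set). 0)"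
      using that by (simp add: Cr_dist_def case_prod_unfold)
    also have "\<dots> = 0" by (rule cSUP_const) (auto intro: exI[of _ "[]"])
    finally show "Cr_dist r f g = 0" .
  qed
  show "Cr_dist r f h \<le> Cr_dist r f g + Cr_dist r g h"
    if "f \<in> Cr_maps r" "g \<in> Cr_maps r" "h \<in> Cr_maps r" for f g h :: "torus \<Rightarrow> 'a"
  proof -
    have "(SUP (js, v) \<in> {js. length js \<le> r} \<times> UNIV.
        norm (partials js (lift f) v - partials js (lift h) v)) \<le> Cr_dist r f g + Cr_dist r g h"
    proof (rule cSUP_least)
      show "{js :: 2 list. length js \<le> r} \<times> (UNIV :: (real ^ 2) set) \<noteq> {}"
        by (auto intro: exI[of _ "[]"])
    next
      fix p :: "2 list \<times> (real ^ 2)" assume "p \<in> {js. length js \<le> r} \<times> UNIV"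
      then obtain js v where p: "p = (js, v)" and len: "length js \<le> r" by blast
      have "norm (partials js (lift f) v - partials js (lift h) v) \<le> Cr_dist r f g + Cr_dist r g h"
        using Cr_dist_upper[OF that(1,2) len, of v] Cr_dist_upper[OF that(2,3) len, of v]
          norm_triangle_ineq[of "partials js (lift f) v - partials js (lift g) v"
            "partials js (lift g) v - partials js (lift h) v"]
        by simp
      then show "(case p of (js, v) \<Rightarrow> norm (partials js (lift f) v - partials js (lift h) v))
          \<le> Cr_dist r f g + Cr_dist r g h" by (simp add: p)
    qed
    then show ?thesis using that by (simp add: Cr_dist_def[of r f h])
  qed
qed

lemma topspace_Cr_topology: "topspace (Cr_topology r) = Cr_maps r"
  unfolding Cr_topology_def by (rule Metric_space.topspace_mtopology[OF Metric_space_Cr])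

section \<open>Residual sets\<close>

definition residual_in :: "'a topology \<Rightarrow> 'a set \<Rightarrow> bool" where
  "residual_in X R \<longleftrightarrow> R \<subseteq> topspace X \<and>
     (\<exists>U :: nat \<Rightarrow> 'a set. (\<forall>n. openin X (U n) \<and> X closure_of U n = topspace X) \<and>
        (\<Inter>n. U n) \<subseteq> R)"

end

theory Submission
  imports Defs
begin

text \<open>
  Nondegeneracy of \<open>\<psi>\<close> says that the vector of \<open>det D\<psi>\<close> and its two first partial derivatives, a
  quadratic expression in the derivatives of \<open>\<psi>\<close> of order 1 and 2, vanishes nowhere. This is an
  open condition by compactness. For density, first average \<open>\<psi>\<close> over short segments in both coordinate
  directions, which makes its derivatives up to order \<open>r\<close> Lipschitz (for \<open>r = 2\<close>, mere continuity would
  not suffice: a continuous image of a surface can fill a 3-dimensional cube). Then three conditions on a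
  2-dimensional domain are avoided by a generic choice of three parameters, the bad parameters forming a
  Lipschitz image of a plane set in \<open>\<real>\<^sup>3\<close>. This is done twice: first to obtain \<open>D\<psi> \<noteq> 0\<close> everywhere, and
  then, near a point where the gradient of one component is nonzero, by perturbing the other component,
  on which the determinant depends affinely. Local perturbations are patched over a finite cover by openness.
\<close>

section \<open>Partial derivatives\<close>

definition Ck :: "nat \<Rightarrow> (real ^ 2 \<Rightarrow> 'b::real_normed_vector) \<Rightarrow> bool" where
  "Ck r F \<longleftrightarrow> (\<forall>js. length js < r \<longrightarrow> (\<forall>v. partials js F differentiable (at v))) \<and>
     (\<forall>js. length js \<le> r \<longrightarrow> continuous_on UNIV (partials js F))"

lemma Cr_maps_iff_Ck: "f \<in> Cr_maps r \<longleftrightarrow> Ck r (lift f)"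
  by (simp add: Cr_maps_def Ck_def)

lemma partials_Nil [simp]: "partials [] F = F"
  by (simp add: partials_def)

lemma partials_Cons [simp]: "partials (i # js) F = partial i (partials js F)"
  by (simp add: partials_def)

lemma partial_eqI: "(F has_derivative D) (at v) \<Longrightarrow> partial i F v = D (axis i 1)"
  unfolding partial_def using frechet_derivative_at by metis

lemma CkI:
  assumes "\<And>js. length js \<le> r \<Longrightarrow> partials js F = P js"
    and "\<And>js v. length js < r \<Longrightarrow> P js differentiable (at v)"
    and "\<And>js. length js \<le> r \<Longrightarrow> continuous_on UNIV (P js)"
  shows "Ck r F"
  unfolding Ck_def using assms by simp

lemma partials_add:
  assumes "Ck r F" "Ck r G" "length js \<le> r"
  shows "partials js (\<lambda>v. F v + G v) = (\<lambda>v. partials js F v + partials js G v)"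
  using assms(3)
proof (induction js)
  case (Cons i js)
  have *: "partial i (\<lambda>v. partials js F v + partials js G v) v =
      partial i (partials js F) v + partial i (partials js G) v" for v
  proof -
    have "partials js F differentiable (at v)" "partials js G differentiable (at v)"
      using assms Cons.prems by (auto simp: Ck_def)
    then have "((\<lambda>v. partials js F v + partials js G v) has_derivative
        (\<lambda>k. frechet_derivative (partials js F) (at v) k +
          frechet_derivative (partials js G) (at v) k)) (at v)"
      by (intro has_derivative_add) (auto simp: frechet_derivative_works)
    from partial_eqI[OF this] show ?thesis by (simp add: partial_def)
  qed
  have IH: "partials js (\<lambda>v. F v + G v) = (\<lambda>v. partials js F v + partials js G v)"
    using Cons by simp
  show ?case unfolding partials_Cons IH by (rule ext, rule *)
qed simp

lemma partials_scaleR: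
  assumes "Ck r F" "length js \<le> r"
  shows "partials js (\<lambda>v. c *\<^sub>R F v) = (\<lambda>v. c *\<^sub>R partials js F v)"
  using assms(2)
proof (induction js)
  case (Cons i js)
  have *: "partial i (\<lambda>v. c *\<^sub>R partials js F v) v = c *\<^sub>R partial i (partials js F) v" for v
  proof -
    have "partials js F differentiable (at v)"
      using assms Cons.prems by (auto simp: Ck_def)
    then have "((\<lambda>v. c *\<^sub>R partials js F v) has_derivative
        (\<lambda>k. c *\<^sub>R frechet_derivative (partials js F) (at v) k)) (at v)"
      by (intro has_derivative_scaleR_right) (auto simp: frechet_derivative_works)
    from partial_eqI[OF this] show ?thesis by (simp add: partial_def)
  qed
  have IH: "partials js (\<lambda>v. c *\<^sub>R F v) = (\<lambda>v. c *\<^sub>R partials js F v)"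
    using Cons by simp
  show ?case unfolding partials_Cons IH by (rule ext, rule *)
qed simp

lemma Ck_add: "Ck r F \<Longrightarrow> Ck r G \<Longrightarrow> Ck r (\<lambda>v. F v + G v)"
  by (rule CkI[OF partials_add]) (auto simp: Ck_def intro!: differentiable_add continuous_on_add)

lemma Ck_scaleR: "Ck r F \<Longrightarrow> Ck r (\<lambda>v. c *\<^sub>R F v)"
  by (rule CkI[OF partials_scaleR])
     (auto simp: Ck_def intro!: differentiable_scaleR continuous_on_scaleR)

lemma partials_wave:
  "partials js (\<lambda>v. sin (a \<bullet> v + b) *\<^sub>R w) =
    (\<lambda>v. sin (a \<bullet> v + (b + length js * (pi / 2))) *\<^sub>R ((\<Prod>i\<leftarrow>js. a \<bullet> axis i 1) *\<^sub>R w))"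
proof (induction js)
  case (Cons i js)
  let ?c = "(\<Prod>i\<leftarrow>js. a \<bullet> axis i 1) *\<^sub>R w"
  have "((\<lambda>v. sin (a \<bullet> v + (b + length js * (pi / 2))) *\<^sub>R ?c) has_derivative
      (\<lambda>k. (cos (a \<bullet> v + (b + length js * (pi / 2))) * (a \<bullet> k)) *\<^sub>R ?c)) (at v)" for v
    by (auto intro!: derivative_eq_intros simp: algebra_simps)
  from partial_eqI[OF this, of i]
  have "partial i (\<lambda>v. sin (a \<bullet> v + (b + length js * (pi / 2))) *\<^sub>R ?c) v =
     (sin (a \<bullet> v + (b + length js * (pi / 2)) + pi / 2) * (a \<bullet> axis i 1)) *\<^sub>R ?c" for v
    by (simp add: sin_add)
  then show ?case unfolding partials_Cons Cons.IH
    by (simp add: fun_eq_iff algebra_simps add_divide_distrib)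
qed simp

lemma Ck_wave: "Ck r (\<lambda>v. sin (a \<bullet> v + b) *\<^sub>R w)"
proof (rule CkI[OF partials_wave])
  show "(\<lambda>v. sin (a \<bullet> v + (b + length js * (pi / 2))) *\<^sub>R ((\<Prod>i\<leftarrow>js. a \<bullet> axis i 1) *\<^sub>R w))
     differentiable (at v)" for js :: "2 list" and v
    unfolding differentiable_def by (rule exI) (auto intro!: derivative_eq_intros)
qed (auto intro!: continuous_intros)

definition periodic :: "(real ^ 2 \<Rightarrow> 'b) \<Rightarrow> bool" where
  "periodic F \<longleftrightarrow> (\<forall>v a. (\<forall>i. a $ i \<in> \<int>) \<longrightarrow> F (v + a) = F v)"

lemma lift_comp_rep:
  assumes "periodic F" shows "lift (F \<circ> rep) = F"
proof
  fix v
  define a where "a = rep (proj v) - v"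
  have "proj (rep (proj v)) = proj v" by simp
  then have "\<forall>i. a $ i \<in> \<int>" unfolding proj_eq_iff by (simp add: a_def)
  then have "F (v + a) = F v" using assms by (simp add: periodic_def)
  then show "lift (F \<circ> rep) v = F v" by (simp add: lift_def a_def)
qed

lemma periodic_wave:
  assumes "\<And>i. k $ i \<in> \<int>" shows "periodic (\<lambda>v. sin (((2 * pi) *\<^sub>R k) \<bullet> v + b) *\<^sub>R w)"
  unfolding periodic_def
proof (intro allI impI)
  fix v a :: "real ^ 2" assume "\<forall>i. a $ i \<in> \<int>"
  with assms have "k \<bullet> a \<in> \<int>" by (auto simp: inner_vec_def intro!: Ints_sum)
  then obtain n where n: "k \<bullet> a = of_int n" by (auto elim: Ints_cases)
  have "((2 * pi) *\<^sub>R k) \<bullet> (v + a) + b = (((2 * pi) *\<^sub>R k) \<bullet> v + b) + 2 * pi * of_int n"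
    by (simp add: inner_add_right algebra_simps n)
  moreover have "sin (x + 2 * pi * of_int n) = sin x" for x :: real
    unfolding sin_add sin_int_2pin cos_int_2pin by simp
  ultimately show "sin (((2 * pi) *\<^sub>R k) \<bullet> (v + a) + b) *\<^sub>R w = sin (((2 * pi) *\<^sub>R k) \<bullet> v + b) *\<^sub>R w"
    by metis
qed

section \<open>Steklov averages\<close>

definition steklov :: "real \<Rightarrow> 'a::real_normed_vector \<Rightarrow> ('a \<Rightarrow> 'b::banach) \<Rightarrow> 'a \<Rightarrow> 'b" where
  "steklov h e G v = integral {0..1} (\<lambda>t. G (v + (h * t) *\<^sub>R e))"

lemma steklov_integrable:
  fixes G :: "'a::real_normed_vector \<Rightarrow> 'b::banach"
  assumes "continuous_on UNIV G"
  shows "(\<lambda>t. G (v + (h * t) *\<^sub>R e)) integrable_on {0..1::real}"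
  by (rule integrable_continuous_real, rule continuous_on_compose2[OF assms])
     (auto intro!: continuous_intros)

lemma norm_steklov_diff_le:
  fixes G :: "'a::real_normed_vector \<Rightarrow> 'b::banach"
  assumes "continuous_on UNIV G" "continuous_on UNIV G'"
    and B: "\<And>t. t \<in> {0..1} \<Longrightarrow> norm (G (v + (h * t) *\<^sub>R e) - G' (w + (h * t) *\<^sub>R e)) \<le> B"
  shows "norm (steklov h e G v - steklov h e G' w) \<le> B"
proof -
  have B0: "0 \<le> B" using order_trans[OF norm_ge_zero B[of 0]] by simp
  have "((\<lambda>t. G (v + (h * t) *\<^sub>R e) - G' (w + (h * t) *\<^sub>R e)) has_integral
      (steklov h e G v - steklov h e G' w)) {0..1}"
    unfolding steklov_def
    by (intro has_integral_diff integrable_integral steklov_integrable assms)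
  from has_integral_bound_real[OF B0 _ this, of "{}"] B show ?thesis by simp
qed

lemma steklov_const: "steklov h e (\<lambda>_. c) v = c"
  by (simp add: steklov_def)

lemma continuous_steklov:
  fixes G :: "'a::real_normed_vector \<Rightarrow> 'b::banach"
  assumes "continuous_on UNIV G" shows "continuous_on UNIV (steklov h e G)"
proof -
  have "continuous_on (UNIV \<times> cbox 0 1) (\<lambda>(v, t). G (v + (h * t) *\<^sub>R e))"
    by (auto simp: case_prod_unfold intro!: continuous_on_compose2[OF assms] continuous_intros)
  from integral_continuous_on_param[OF this] show ?thesis
    unfolding steklov_def by simp
qed

lemma steklov_has_derivative:
  fixes G :: "real ^ 2 \<Rightarrow> 'b::banach"
  assumes diff: "\<And>v. G differentiable (at v)" and cont: "\<And>i. continuous_on UNIV (partial i G)"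
  shows "(steklov h e G has_derivative (\<lambda>k. \<Sum>i\<in>UNIV. k $ i *\<^sub>R steklov h e (partial i G) v)) (at v)"
proof -
  have bl: "bounded_linear (\<lambda>k::real^2. k $ i)" for i
    by (rule bounded_linear_vec_nth)
  define D where "D v = (\<Sum>i\<in>UNIV. blinfun_compose (blinfun_scaleR_left (partial i G v)) (Blinfun (\<lambda>k::real^2. k $ i)))" for v
  have D: "blinfun_apply (D v) = (\<lambda>k. \<Sum>i\<in>UNIV. k $ i *\<^sub>R partial i G v)" for v
    by (auto simp: D_def blinfun.sum_left bounded_linear_Blinfun_apply[OF bl])
  have contD: "continuous_on UNIV D"
    unfolding D_def by (intro continuous_intros cont bounded_linear.continuous_on[OF bounded_linear_blinfun_scaleR_left])
  have contG: "continuous_on UNIV G"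
    using diff by (simp add: continuous_on_eq_continuous_at differentiable_imp_continuous_within)
  have GD: "(G has_derivative blinfun_apply (D v)) (at v)" for v
  proof -
    let ?f = "frechet_derivative G (at v)"
    have f: "(G has_derivative ?f) (at v)" using diff by (simp add: frechet_derivative_works)
    have lin: "linear ?f" using f has_derivative_linear by blast
    have "?f k = blinfun_apply (D v) k" for k
    proof -
      have "?f k = ?f (\<Sum>i\<in>UNIV. k $ i *\<^sub>R axis i 1)"
        using basis_expansion[of k] by (simp add: scalar_mult_eq_scaleR)
      also have "\<dots> = (\<Sum>i\<in>UNIV. k $ i *\<^sub>R ?f (axis i 1))"
        by (simp add: linear_sum[OF lin] linear_scale[OF lin])
      finally show ?thesis by (simp add: D partial_def)
    qed
    then show ?thesis using f by (metis ext)
  qed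
  have "((\<lambda>v. integral (cbox 0 1) (\<lambda>t. G (v + (h * t) *\<^sub>R e))) has_derivative
      blinfun_apply (integral (cbox 0 1) (\<lambda>t. D (v + (h * t) *\<^sub>R e)))) (at v within UNIV)"
  proof (rule leibniz_rule)
    fix x :: "real^2" and t :: real
    have "(G \<circ> (\<lambda>x. x + (h * t) *\<^sub>R e) has_derivative blinfun_apply (D (x + (h * t) *\<^sub>R e)) \<circ> (\<lambda>k. k)) (at x)"
      by (rule diff_chain_at[OF _ GD]) (auto intro!: derivative_eq_intros)
    then show "((\<lambda>x. G (x + (h * t) *\<^sub>R e)) has_derivative blinfun_apply (D (x + (h * t) *\<^sub>R e))) (at x within UNIV)"
      by (simp add: o_def)
  next
    show "(\<lambda>t. G (x + (h * t) *\<^sub>R e)) integrable_on cbox 0 1" for x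
      using steklov_integrable[OF contG] by simp
    show "continuous_on (UNIV \<times> cbox 0 1) (\<lambda>(x, t). D (x + (h * t) *\<^sub>R e))"
      by (auto simp: case_prod_unfold intro!: continuous_on_compose2[OF contD] continuous_intros)
  qed auto
  moreover have "blinfun_apply (integral (cbox 0 1) (\<lambda>t. D (v + (h * t) *\<^sub>R e))) =
      (\<lambda>k. \<Sum>i\<in>UNIV. k $ i *\<^sub>R steklov h e (partial i G) v)"
  proof
    fix k
    have "blinfun_apply (integral {0..1} (\<lambda>t. D (v + (h * t) *\<^sub>R e))) k =
       integral {0..1} (\<lambda>t. blinfun_apply (D (v + (h * t) *\<^sub>R e)) k)"
      by (rule blinfun_apply_integral) (rule steklov_integrable[OF contD])
    also have "\<dots> = (\<Sum>i\<in>UNIV. k $ i *\<^sub>R steklov h e (partial i G) v)"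
      unfolding D steklov_def
      by (subst integral_sum)
         (auto intro!: integrable_cmul steklov_integrable continuous_intros cont)
    finally show "blinfun_apply (integral (cbox 0 1) (\<lambda>t. D (v + (h * t) *\<^sub>R e))) k =
      (\<Sum>i\<in>UNIV. k $ i *\<^sub>R steklov h e (partial i G) v)" by simp
  qed
  ultimately show ?thesis by (simp add: steklov_def[abs_def])
qed

lemma partials_steklov:
  fixes F :: "real ^ 2 \<Rightarrow> 'b::banach"
  assumes "Ck r F" "length js \<le> r"
  shows "partials js (steklov h e F) = steklov h e (partials js F)"
  using assms(2)
proof (induction js)
  case (Cons i js)
  have "(steklov h e (partials js F) has_derivative
      (\<lambda>k. \<Sum>i\<in>UNIV. k $ i *\<^sub>R steklov h e (partial i (partials js F)) v)) (at v)" for v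
    using assms(1) Cons.prems unfolding Ck_def
    by (intro steklov_has_derivative) (auto simp flip: partials_Cons)
  from partial_eqI[OF this] Cons show ?case
    by (auto simp: axis_def if_distrib[of "\<lambda>c. c *\<^sub>R _"] cong: if_cong)
qed simp

lemma Ck_steklov:
  fixes F :: "real ^ 2 \<Rightarrow> 'b::banach"
  assumes "Ck r F" shows "Ck r (steklov h e F)"
proof (rule CkI[OF partials_steklov[OF assms]])
  fix js :: "2 list" and v assume "length js < r"
  then have "(steklov h e (partials js F) has_derivative
      (\<lambda>k. \<Sum>i\<in>UNIV. k $ i *\<^sub>R steklov h e (partial i (partials js F)) v)) (at v)"
    using assms unfolding Ck_def
    by (intro steklov_has_derivative) (auto simp flip: partials_Cons)
  then show "steklov h e (partials js F) differentiable (at v)" by (rule differentiableI)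
qed (use assms in \<open>auto simp: Ck_def intro: continuous_steklov\<close>)

lemma steklov_Lipschitz:
  fixes G :: "'a::real_normed_vector \<Rightarrow> 'b::banach"
  assumes G: "continuous_on UNIV G" and h: "h > 0" and M: "\<And>v. norm (G v) \<le> M"
  shows "norm (steklov h e G (v + s *\<^sub>R e) - steklov h e G v) \<le> (2 * M / h) * \<bar>s\<bar>"
proof -
  define g where "g u = G (v + u *\<^sub>R e)" for u
  define a b where "a = - \<bar>s\<bar>" and "b = \<bar>s\<bar> + h"
  have "continuous_on {a..b} g" unfolding g_def
    by (auto intro!: continuous_on_compose2[OF G] continuous_intros)
  then obtain P where P: "\<And>u. u \<in> {a..b} \<Longrightarrow> (P has_vector_derivative g u) (at u within {a..b})"
    by (metis antiderivative_continuous)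
  have bd: "norm (P x - P y) \<le> M * \<bar>x - y\<bar>" if "x \<in> {a..b}" "y \<in> {a..b}" for x y
  proof -
    have "norm (P x - P y) \<le> M * norm (x - y)"
    proof (rule differentiable_bound[where S = "{a..b}" and f' = "\<lambda>u k. k *\<^sub>R g u"])
      show "(P has_derivative (\<lambda>k. k *\<^sub>R g u)) (at u within {a..b})" if "u \<in> {a..b}" for u
        using P[OF that] by (simp add: has_vector_derivative_def)
      show "onorm (\<lambda>k. k *\<^sub>R g u) \<le> M" for u
        by (rule onorm_bound) (use M[of "v + u *\<^sub>R e"] order_trans[OF norm_ge_zero M]
            in \<open>auto simp: g_def mult.commute[of M] intro!: mult_left_mono\<close>)
    qed (use that in auto)
    then show ?thesis by simp
  qed
  have eq: "steklov h e G (v + z *\<^sub>R e) = (1 / h) *\<^sub>R (P (z + h) - P z)"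
    if z: "a \<le> z" "z + h \<le> b" for z
  proof -
    have "((\<lambda>t. g (z + h * t)) has_integral (1 / h) *\<^sub>R P (z + h * 1) - (1 / h) *\<^sub>R P (z + h * 0)) {0..1}"
    proof (rule fundamental_theorem_of_calculus)
      fix t :: real assume t: "t \<in> {0..1}"
      have sub: "(\<lambda>t. z + h * t) ` {0..1} \<subseteq> {a..b}"
      proof clarsimp
        fix t :: real assume "0 \<le> t" "t \<le> 1"
        then have "0 \<le> h * t" "h * t \<le> h" using h by auto
        then show "a \<le> z + h * t \<and> z + h * t \<le> b" using z by linarith
      qed
      have "(P \<circ> (\<lambda>t. z + h * t) has_vector_derivative h *\<^sub>R g (z + h * t)) (at t within {0..1})"
      proof (rule vector_diff_chain_within)
        show "((\<lambda>t. z + h * t) has_vector_derivative h) (at t within {0..1})"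
          by (auto intro!: derivative_eq_intros simp: has_real_derivative_iff_has_vector_derivative[symmetric])
        show "(P has_vector_derivative g (z + h * t)) (at (z + h * t) within (\<lambda>t. z + h * t) ` {0..1})"
          by (rule has_vector_derivative_within_subset[OF P sub]) (use sub t in \<open>simp add: image_subset_iff\<close>)
      qed
      then have "((\<lambda>t. (1 / h) *\<^sub>R (P \<circ> (\<lambda>t. z + h * t)) t) has_vector_derivative (1 / h) *\<^sub>R h *\<^sub>R g (z + h * t)) (at t within {0..1})"
        by (intro bounded_linear.has_vector_derivative[OF bounded_linear_scaleR_right])
      then show "((\<lambda>t. (1 / h) *\<^sub>R P (z + h * t)) has_vector_derivative g (z + h * t)) (at t within {0..1})"
        using h by (simp add: o_def)
    qed simp
    then have "integral {0..1} (\<lambda>t. g (z + h * t)) = (1 / h) *\<^sub>R (P (z + h) - P z)"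
      by (simp add: integral_unique scaleR_diff_right)
    then show ?thesis by (simp add: steklov_def g_def algebra_simps)
  qed
  have "steklov h e G (v + s *\<^sub>R e) - steklov h e G (v + 0 *\<^sub>R e) =
     (1 / h) *\<^sub>R ((P (s + h) - P h) - (P s - P 0))"
    by (subst eq, force simp: a_def b_def, force simp: b_def, subst eq)
       (auto simp: a_def b_def scaleR_diff_right)
  then have "norm (steklov h e G (v + s *\<^sub>R e) - steklov h e G v) =
     norm ((P (s + h) - P h) - (P s - P 0)) / h" using h by (simp add: divide_inverse_commute)
  moreover have "norm ((P (s + h) - P h) - (P s - P 0)) \<le> M * \<bar>s\<bar> + M * \<bar>s\<bar>"
    using bd[of "s + h" h] bd[of s 0] h norm_triangle_ineq4[of "P (s + h) - P h" "P s - P 0"]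
    by (simp add: a_def b_def) linarith
  ultimately show ?thesis using h by (simp add: divide_right_mono)
qed

lemma Cr_dist_le:
  assumes "f \<in> Cr_maps r" "g \<in> Cr_maps r"
    and "\<And>js v. length js \<le> r \<Longrightarrow> norm (partials js (lift f) v - partials js (lift g) v) \<le> B"
  shows "Cr_dist r f g \<le> B"
proof -
  have "(SUP (js, v) \<in> {js. length js \<le> r} \<times> UNIV.
      norm (partials js (lift f) v - partials js (lift g) v)) \<le> B"
  proof (rule cSUP_least)
    show "{js :: 2 list. length js \<le> r} \<times> (UNIV :: (real ^ 2) set) \<noteq> {}"
      by (auto intro: exI[of _ "[]"])
  qed (use assms(3) in auto)
  with assms(1,2) show ?thesis by (simp add: Cr_dist_def)
qed

lemma periodic_uniformly_continuous:
  fixes F :: "real ^ 2 \<Rightarrow> 'b::metric_space"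
  assumes "continuous_on UNIV F" "periodic F"
  shows "uniformly_continuous_on UNIV F"
  unfolding uniformly_continuous_on_def
proof (intro allI impI)
  fix \<epsilon> :: real assume "\<epsilon> > 0"
  let ?B = "cbox (\<chi> i. -1) (\<chi> i. 2) :: (real ^ 2) set"
  have "uniformly_continuous_on ?B F"
    by (intro compact_uniformly_continuous compact_cbox continuous_on_subset[OF assms(1)]) auto
  with \<open>\<epsilon> > 0\<close> obtain d where d: "d > 0"
    "\<And>x y. x \<in> ?B \<Longrightarrow> y \<in> ?B \<Longrightarrow> dist y x < d \<Longrightarrow> dist (F y) (F x) < \<epsilon>"
    unfolding uniformly_continuous_on_def by metis
  show "\<exists>d>0. \<forall>x\<in>UNIV. \<forall>y\<in>UNIV. dist y x < d \<longrightarrow> dist (F y) (F x) < \<epsilon>"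
  proof (intro exI conjI ballI impI)
    show "min d 1 > 0" using d by simp
    fix x y :: "real ^ 2" assume xy: "dist y x < min d 1"
    define a :: "real ^ 2" where "a = (\<chi> i. - of_int \<lfloor>x $ i\<rfloor>)"
    have F: "F (z + a) = F z" for z using assms(2) by (simp add: periodic_def a_def)
    have xa: "0 \<le> (x + a) $ i" "(x + a) $ i \<le> 1" for i
      unfolding a_def by (simp_all, linarith)
    have "\<bar>(y - x) $ i\<bar> \<le> 1" for i
      using component_le_norm_cart[of "y - x" i] xy by (simp add: dist_norm)
    then have ya: "\<bar>(y + a) $ i - (x + a) $ i\<bar> \<le> 1" for i by simp
    have "- 1 \<le> (x + a) $ i \<and> (x + a) $ i \<le> 2" "- 1 \<le> (y + a) $ i \<and> (y + a) $ i \<le> 2" for i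
      using xa[of i] ya[of i] by linarith+
    then have "x + a \<in> ?B" "y + a \<in> ?B"
      unfolding mem_box_cart vec_lambda_beta by blast+
    then have "dist (F (y + a)) (F (x + a)) < \<epsilon>" using xy by (intro d) auto
    then show "dist (F y) (F x) < \<epsilon>" by (simp add: F)
  qed
qed

lemma periodic_partials_lift: "periodic (partials js (lift f))"
  unfolding periodic_def by (simp add: partials_periodic)

lemma periodic_steklov: "periodic F \<Longrightarrow> periodic (steklov h e F)"
  unfolding periodic_def steklov_def by (simp add: add.assoc[symmetric] add.commute[of _ "_ *\<^sub>R _"])

definition directionally_Lipschitz :: "nat \<Rightarrow> 2 \<Rightarrow> (torus \<Rightarrow> 'b::real_normed_vector) \<Rightarrow> bool" where
  "directionally_Lipschitz r i f \<longleftrightarrow> (\<forall>js. length js \<le> r \<longrightarrow>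
     (\<exists>L. \<forall>v s. norm (partials js (lift f) (v + s *\<^sub>R axis i 1) - partials js (lift f) v) \<le> L * \<bar>s\<bar>))"

lemma directionally_Lipschitz_approximation:
  fixes f :: "torus \<Rightarrow> 'b::banach"
  assumes f: "f \<in> Cr_maps r" and "\<eta> > 0"
  obtains g where "g \<in> Cr_maps r" "Cr_dist r f g < \<eta>" "directionally_Lipschitz r i g"
    "\<And>k. directionally_Lipschitz r k f \<Longrightarrow> directionally_Lipschitz r k g"
proof -
  let ?J = "{js :: 2 list. length js \<le> r}"
  let ?e = "axis i 1 :: real ^ 2"
  have fin: "finite ?J" using finite_lists_length_le[of "UNIV :: 2 set" r] by simp
  have cont: "continuous_on UNIV (partials js (lift f))" if "js \<in> ?J" for js :: "2 list"
    using that f by (simp add: Cr_maps_def)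
  have "\<forall>js\<in>?J. \<exists>d>0. \<forall>x y. dist y x < d \<longrightarrow>
      dist (partials js (lift f) y) (partials js (lift f) x) < \<eta> / 2"
    using periodic_uniformly_continuous[OF cont periodic_partials_lift] \<open>\<eta> > 0\<close>
    unfolding uniformly_continuous_on_def by (metis UNIV_I half_gt_zero)
  then obtain d :: "2 list \<Rightarrow> real" where d: "\<And>js. js \<in> ?J \<Longrightarrow> d js > 0"
    "\<And>js x y. js \<in> ?J \<Longrightarrow> dist y x < (d :: 2 list \<Rightarrow> real) js \<Longrightarrow>
      dist (partials js (lift f) y) (partials js (lift f) x) < \<eta> / 2"
    by metis
  have "Min (d ` ?J) > 0" using fin d(1) by (subst Min_gr_iff) (auto intro: exI[of _ "[]"])
  then obtain h where h: "0 < h" "h < Min (d ` ?J)" using dense by blast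
  have hd: "h < d js" if "js \<in> ?J" for js :: "2 list"
    using h(2) fin that by (meson Min_le finite_imageI imageI less_le_trans)
  define g where "g = steklov h ?e (lift f) \<circ> rep"
  have "periodic (lift f)" using periodic_partials_lift[of "[]" f] by simp
  then have lg: "lift g = steklov h ?e (lift f)"
    unfolding g_def by (intro lift_comp_rep periodic_steklov)
  have Ckf: "Ck r (lift f)" using f by (simp add: Cr_maps_iff_Ck)
  have pg: "partials js (lift g) = steklov h ?e (partials js (lift f))" if "js \<in> ?J" for js :: "2 list"
    using that by (simp add: lg partials_steklov[OF Ckf])
  have g: "g \<in> Cr_maps r" using Ckf by (simp add: Cr_maps_iff_Ck lg Ck_steklov)
  have "Cr_dist r f g \<le> \<eta> / 2"
  proof (rule Cr_dist_le[OF f g])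
    fix js :: "2 list" and v assume "length js \<le> r"
    then have js: "js \<in> ?J" by simp
    have "norm (steklov h ?e (partials js (lift f)) v - steklov h ?e (\<lambda>_. partials js (lift f) v) v) \<le> \<eta> / 2"
    proof (rule norm_steklov_diff_le)
      fix t :: real assume "t \<in> {0..1}"
      then have "h * t \<le> h" "0 \<le> h * t" using h by auto
      then have "dist (v + (h * t) *\<^sub>R ?e) v < d js" using hd[OF js] by (simp add: dist_norm)
      from d(2)[OF js this] show "norm (partials js (lift f) (v + (h * t) *\<^sub>R ?e) - partials js (lift f) v) \<le> \<eta> / 2"
        by (simp add: dist_norm)
    qed (use cont[OF js] in auto)
    then show "norm (partials js (lift f) v - partials js (lift g) v) \<le> \<eta> / 2"
      by (simp add: pg[OF js] steklov_const norm_minus_commute)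
  qed
  then have "Cr_dist r f g < \<eta>" using \<open>\<eta> > 0\<close> by simp
  moreover have "directionally_Lipschitz r i g"
    unfolding directionally_Lipschitz_def
  proof (intro allI impI)
    fix js :: "2 list" assume js: "length js \<le> r"
    then obtain M where M: "\<And>v. norm (partials js (lift f) v) \<le> M"
      using bounded_partials[OF f js] unfolding bounded_iff by auto
    show "\<exists>L. \<forall>v s. norm (partials js (lift g) (v + s *\<^sub>R ?e) - partials js (lift g) v) \<le> L * \<bar>s\<bar>"
      using steklov_Lipschitz[OF cont h(1) M] js by (intro exI[of _ "2 * M / h"]) (simp add: pg)
  qed
  moreover have "directionally_Lipschitz r k g" if "directionally_Lipschitz r k f" for k
    unfolding directionally_Lipschitz_def
  proof (intro allI impI)
    fix js :: "2 list" assume js: "length js \<le> r"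
    then obtain L where L: "\<And>v s. norm (partials js (lift f) (v + s *\<^sub>R axis k 1) - partials js (lift f) v) \<le> L * \<bar>s\<bar>"
      using \<open>directionally_Lipschitz r k f\<close> by (metis directionally_Lipschitz_def)
    have "norm (partials js (lift g) (v + s *\<^sub>R axis k 1) - partials js (lift g) v) \<le> L * \<bar>s\<bar>" for v s
    proof -
      have "norm (partials js (lift f) (v + s *\<^sub>R axis k 1 + (h * t) *\<^sub>R ?e) - partials js (lift f) (v + (h * t) *\<^sub>R ?e)) \<le> L * \<bar>s\<bar>" for t
        using L[of "v + (h * t) *\<^sub>R ?e" s] by (simp add: algebra_simps)
      with js show ?thesis by (simp add: pg norm_steklov_diff_le cont)
    qed
    then show "\<exists>L. \<forall>v s. norm (partials js (lift g) (v + s *\<^sub>R axis k 1) - partials js (lift g) v) \<le> L * \<bar>s\<bar>"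
      by blast
  qed
  ultimately show ?thesis using g that by blast
qed

section \<open>Jets\<close>

type_synonym jet = "(real ^ 2 ^ 2) \<times> (real ^ 2 ^ 2 ^ 2)"

text \<open>The first index of an entry of \<open>jet\<close> (or the first two, for second derivatives) gives the direction, the last one the component of \<open>F\<close>.\<close>

definition jet :: "(real ^ 2 \<Rightarrow> real ^ 2) \<Rightarrow> real ^ 2 \<Rightarrow> jet" where
  "jet F v = (\<chi> i. partials [i] F v, \<chi> i k. partials [i, k] F v)"

lemma norm_vec2_le:
  fixes x :: "'a::real_normed_vector ^ 2"
  assumes "\<And>i. norm (x $ i) \<le> B" shows "norm x \<le> 2 * B"
proof -
  have "norm x \<le> (\<Sum>i\<in>UNIV. norm (x $ i))"
    unfolding norm_vec_def by (rule L2_set_le_sum) simp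
  also have "\<dots> \<le> 2 * B" using assms[of 1] assms[of 2] by (simp add: sum_2)
  finally show ?thesis .
qed

lemma norm_jet_diff_le:
  assumes "\<And>js. length js \<le> 2 \<Longrightarrow> norm (partials js F v - partials js G w) \<le> B"
  shows "norm (jet F v - jet G w) \<le> 6 * B"
proof -
  have "norm ((\<chi> i. partials [i] F v) - (\<chi> i. partials [i] G w)) \<le> 2 * B"
    using assms[of "[_]"] by (intro norm_vec2_le) simp
  moreover have "norm ((\<chi> i k. partials [i, k] F v) - (\<chi> i k. partials [i, k] G w)) \<le> 2 * (2 * B)"
    using assms[of "[_, _]"] by (intro norm_vec2_le) simp
  ultimately show ?thesis
    using norm_Pair_le[of "(\<chi> i. partials [i] F v) - (\<chi> i. partials [i] G w)"
      "(\<chi> i k. partials [i, k] F v) - (\<chi> i k. partials [i, k] G w)"]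
    by (simp add: jet_def)
qed

lemma dist_jet_le:
  assumes "f \<in> Cr_maps r" "g \<in> Cr_maps r" "2 \<le> r"
  shows "dist (jet (lift f) v) (jet (lift g) v) \<le> 6 * Cr_dist r f g"
  unfolding dist_norm using assms by (intro norm_jet_diff_le Cr_dist_upper) auto

lemma continuous_jet:
  assumes "Ck r F" "2 \<le> r" shows "continuous_on UNIV (jet F)"
  using assms unfolding jet_def Ck_def
  by (intro continuous_on_Pair continuous_on_vec_lambda) (auto simp del: partials_Cons)

definition Lip_jet_maps :: "nat \<Rightarrow> (torus \<Rightarrow> real ^ 2) set" where
  "Lip_jet_maps r = {f \<in> Cr_maps r. \<exists>L. L-lipschitz_on UNIV (jet (lift f))}"

lemma Lip_jet_maps_dense:
  assumes "f \<in> Cr_maps r" "\<eta> > 0" "2 \<le> r"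
  obtains g where "g \<in> Lip_jet_maps r" "Cr_dist r f g < \<eta>"
proof -
  have \<eta>: "\<eta> / 2 > 0" using \<open>\<eta> > 0\<close> by simp
  obtain g1 where g1: "g1 \<in> Cr_maps r" "Cr_dist r f g1 < \<eta> / 2" "directionally_Lipschitz r 1 g1"
    using directionally_Lipschitz_approximation[OF assms(1) \<eta>] by metis
  obtain g where g: "g \<in> Cr_maps r" "Cr_dist r g1 g < \<eta> / 2" "directionally_Lipschitz r 2 g"
      "directionally_Lipschitz r 1 g"
    using directionally_Lipschitz_approximation[OF g1(1) \<eta>] g1(3) by metis
  have "Cr_dist r f g \<le> Cr_dist r f g1 + Cr_dist r g1 g"
    by (rule Metric_space.triangle[OF Metric_space_Cr assms(1) g1(1) g(1)])
  with g1 g have "Cr_dist r f g < \<eta>" by simp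
  moreover
  have *: "\<exists>L. \<forall>js. length js \<le> 2 \<longrightarrow> (\<forall>v s. norm (partials js (lift g) (v + s *\<^sub>R axis i 1) - partials js (lift g) v) \<le> L * \<bar>s\<bar>)" for i
  proof -
    have fin: "finite {js :: 2 list. length js \<le> 2}"
      using finite_lists_length_le[of "UNIV :: 2 set" 2] by simp
    have "directionally_Lipschitz r i g" using g exhaust_2[of i] by metis
    then have "\<exists>L. \<forall>js. length js \<le> 2 \<longrightarrow> (\<forall>v s. norm (partials js (lift g) (v + s *\<^sub>R axis i 1) - partials js (lift g) v) \<le> L js * \<bar>s\<bar>)"
      unfolding directionally_Lipschitz_def using \<open>2 \<le> r\<close> by (metis order_trans)
    then obtain L where L: "\<And>js v s. length js \<le> 2 \<Longrightarrow> norm (partials js (lift g) (v + s *\<^sub>R axis i 1) - partials js (lift g) v) \<le> L js * \<bar>s\<bar>"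
      by blast
    show ?thesis
    proof (intro exI allI impI)
      fix js :: "2 list" and v s assume js: "length js \<le> 2"
      then have "L js \<le> Max (L ` {js. length js \<le> 2})" using fin by simp
      then show "norm (partials js (lift g) (v + s *\<^sub>R axis i 1) - partials js (lift g) v) \<le> Max (L ` {js. length js \<le> 2}) * \<bar>s\<bar>"
        using L[OF js, of v s] by (meson abs_ge_zero mult_right_mono order_trans)
    qed
  qed
  obtain L1 L2 where L:
    "\<And>js v s. length js \<le> 2 \<Longrightarrow> norm (partials js (lift g) (v + s *\<^sub>R axis 1 1) - partials js (lift g) v) \<le> L1 * \<bar>s\<bar>"
    "\<And>js v s. length js \<le> 2 \<Longrightarrow> norm (partials js (lift g) (v + s *\<^sub>R axis 2 1) - partials js (lift g) v) \<le> L2 * \<bar>s\<bar>"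
    using *[of 1] *[of 2] by metis
  have L0: "L1 \<ge> 0" "L2 \<ge> 0"
    using order_trans[OF norm_ge_zero L(1)[of "[]" 0 1]] order_trans[OF norm_ge_zero L(2)[of "[]" 0 1]] by auto
  have "norm (partials js (lift g) v - partials js (lift g) w) \<le> (L1 + L2) * norm (v - w)"
    if js: "length js \<le> 2" for js v w
  proof -
    let ?P = "partials js (lift g)" and ?d = "v - w"
    have v: "v = (w + ?d $ 1 *\<^sub>R axis 1 1) + ?d $ 2 *\<^sub>R axis 2 1"
      by (simp add: vec_eq_iff forall_2 axis_def)
    have "norm (?P v - ?P w) \<le> norm (?P v - ?P (w + ?d $ 1 *\<^sub>R axis 1 1)) + norm (?P (w + ?d $ 1 *\<^sub>R axis 1 1) - ?P w)"
      by (rule order_trans[OF _ norm_triangle_ineq]) simp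
    also have "\<dots> \<le> L2 * \<bar>?d $ 2\<bar> + L1 * \<bar>?d $ 1\<bar>"
      using L(2)[OF js, of "w + ?d $ 1 *\<^sub>R axis 1 1" "?d $ 2", folded v] L(1)[OF js, of w "?d $ 1"]
      by (rule add_mono)
    also have "\<dots> \<le> L2 * norm ?d + L1 * norm ?d"
      using L0 by (intro add_mono mult_left_mono component_le_norm_cart)
    finally show ?thesis by (simp add: algebra_simps)
  qed
  then have "norm (jet (lift g) v - jet (lift g) w) \<le> 6 * ((L1 + L2) * norm (v - w))" for v w
    by (rule norm_jet_diff_le)
  then have "(6 * (L1 + L2))-lipschitz_on UNIV (jet (lift g))"
    unfolding lipschitz_on_def dist_norm mult.assoc using L0 by simp
  ultimately show ?thesis using that g(1) by (auto simp: Lip_jet_maps_def)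
qed

section \<open>Perturbation lemmas\<close>

lemma exists_small_parameter_avoiding_zeros:
  fixes H :: "real ^ 2 \<Rightarrow> real ^ 3 \<Rightarrow> real ^ 3"
  assumes "c > 0" "\<eta> > 0"
    and expand: "\<And>x p q. x \<in> K \<Longrightarrow> norm p \<le> 1 \<Longrightarrow> norm q \<le> 1 \<Longrightarrow> c * norm (p - q) \<le> norm (H x p - H x q)"
    and lips: "\<And>x y p. x \<in> K \<Longrightarrow> y \<in> K \<Longrightarrow> norm p \<le> 1 \<Longrightarrow> norm (H x p - H y p) \<le> C * norm (x - y)"
  obtains p where "norm p < \<eta>" "\<And>x. x \<in> K \<Longrightarrow> H x p \<noteq> 0"
proof -
  define S where "S = {x \<in> K. \<exists>p. norm p \<le> 1 \<and> H x p = 0}"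
  define g where "g x = (SOME p. norm p \<le> 1 \<and> H x p = 0)" for x
  have g: "norm (g x) \<le> 1" "H x (g x) = 0" if "x \<in> S" for x
    using someI_ex[of "\<lambda>p. norm p \<le> 1 \<and> H x p = 0"] that by (auto simp: S_def g_def)
  have lip: "norm (p - g y) \<le> (C / c) * norm (x - y)"
    if "x \<in> K" "norm p \<le> 1" "H x p = 0" "y \<in> S" for x y p
  proof -
    have y: "y \<in> K" using \<open>y \<in> S\<close> by (simp add: S_def)
    have "c * norm (p - g y) \<le> norm (H x p - H x (g y))"
      using that g by (intro expand) auto
    also have "\<dots> = norm (H x (g y) - H y (g y))" using that g by simp
    also have "\<dots> \<le> C * norm (x - y)" using that g y by (intro lips) auto
    finally show ?thesis using \<open>c > 0\<close> by (simp add: field_simps)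
  qed
  \<comment> \<open>The bad parameters are the Lipschitz image of a null set of \<open>\<real>\<^sup>3\<close>, namely the plane set \<open>S\<close> at height 0.\<close>
  let ?N = "S \<times> {0} :: ((real ^ 2) \<times> real) set"
  have "negligible ?N"
    by (rule negligible_subset[OF negligible_standard_hyperplane[of "(0, 1)" 0]])
       (auto simp: Basis_prod_def)
  then have "negligible ((\<lambda>z. g (fst z)) ` ?N)"
  proof (rule negligible_locally_Lipschitz_image[rotated])
    fix z assume z: "z \<in> ?N"
    have "norm (g (fst y) - g (fst z)) \<le> \<bar>C / c\<bar> * norm (y - z)" if y: "y \<in> ?N" for y
    proof -
      have "norm (g (fst y) - g (fst z)) \<le> (C / c) * norm (fst y - fst z)"
      proof (rule lip)
        have "fst y \<in> S" "fst z \<in> S" using y z by auto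
        then show "fst y \<in> K" "norm (g (fst y)) \<le> 1" "H (fst y) (g (fst y)) = 0" "fst z \<in> S"
          using g by (auto simp: S_def)
      qed
      also have "\<dots> \<le> \<bar>C / c\<bar> * norm (y - z)"
        by (intro mult_mono abs_ge_self) (simp_all flip: fst_diff, metis norm_fst_le prod.collapse)
      finally show ?thesis .
    qed
    then show "\<exists>T B. open T \<and> z \<in> T \<and> (\<forall>y\<in>?N \<inter> T. norm (g (fst y) - g (fst z)) \<le> B * norm (y - z))"
      by (intro exI[of _ UNIV] exI[of _ "\<bar>C / c\<bar>"]) auto
  qed simp
  moreover have "\<not> negligible (ball 0 (min \<eta> 1) :: (real ^ 3) set)"
    by (rule open_not_negligible) (use \<open>\<eta> > 0\<close> in auto)
  ultimately have "\<not> ball 0 (min \<eta> 1) \<subseteq> (\<lambda>z. g (fst z)) ` ?N"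
    using negligible_subset by blast
  then obtain p where p: "norm p < \<eta>" "norm p < 1" "p \<notin> g ` S" by force
  have "H x p \<noteq> 0" if "x \<in> K" for x
  proof
    assume "H x p = 0"
    then have xS: "x \<in> S" using p that by (force simp: S_def)
    have "p = g x" using lip[OF that _ \<open>H x p = 0\<close> xS] p by simp
    with xS p(3) show False by blast
  qed
  with p(1) show ?thesis by (rule that)
qed

lemma lift_add: "lift (\<lambda>x. f x + g x) = (\<lambda>v. lift f v + lift g v)"
  by (simp add: lift_def fun_eq_iff)

lemma lift_scaleR: "lift (\<lambda>x. c *\<^sub>R f x) = (\<lambda>v. c *\<^sub>R lift f v)"
  by (simp add: lift_def fun_eq_iff)

lemma jet_add:
  assumes "Ck r F" "Ck r G" "2 \<le> r"
  shows "jet (\<lambda>v. F v + G v) = (\<lambda>v. jet F v + jet G v)"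
  using assms unfolding jet_def
  by (simp add: partials_add[of r] vec_eq_iff fun_eq_iff del: partials_Cons)

lemma jet_scaleR:
  assumes "Ck r F" "2 \<le> r"
  shows "jet (\<lambda>v. c *\<^sub>R F v) = (\<lambda>v. c *\<^sub>R jet F v)"
  using assms unfolding jet_def
  by (simp add: partials_scaleR[of r] vec_eq_iff fun_eq_iff del: partials_Cons)

lemma Cr_maps_add: "f \<in> Cr_maps r \<Longrightarrow> g \<in> Cr_maps r \<Longrightarrow> (\<lambda>x. f x + g x) \<in> Cr_maps r"
  by (simp add: Cr_maps_iff_Ck lift_add Ck_add)

lemma Cr_maps_scaleR: "f \<in> Cr_maps r \<Longrightarrow> (\<lambda>x. c *\<^sub>R f x) \<in> Cr_maps r"
  by (simp add: Cr_maps_iff_Ck lift_scaleR Ck_scaleR)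

lemma Lip_jet_maps_add:
  assumes "f \<in> Lip_jet_maps r" "g \<in> Lip_jet_maps r" "2 \<le> r"
  shows "(\<lambda>x. f x + g x) \<in> Lip_jet_maps r"
proof -
  obtain L L' where "L-lipschitz_on UNIV (jet (lift f))" "L'-lipschitz_on UNIV (jet (lift g))"
    using assms by (auto simp: Lip_jet_maps_def)
  then have "(L + L')-lipschitz_on UNIV (\<lambda>v. jet (lift f) v + jet (lift g) v)"
    by (rule lipschitz_on_add)
  then show ?thesis using assms
    by (auto simp: Lip_jet_maps_def Cr_maps_add lift_add jet_add[of r] Cr_maps_iff_Ck[symmetric])
qed

lemma Lip_jet_maps_scaleR:
  assumes "f \<in> Lip_jet_maps r" "2 \<le> r"
  shows "(\<lambda>x. c *\<^sub>R f x) \<in> Lip_jet_maps r"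
proof -
  obtain L where "L-lipschitz_on UNIV (jet (lift f))"
    using assms by (auto simp: Lip_jet_maps_def)
  then have "(\<bar>c\<bar> * L)-lipschitz_on UNIV (\<lambda>v. c *\<^sub>R jet (lift f) v)"
    by (rule lipschitz_on_cmult)
  then show ?thesis using assms
    by (auto simp: Lip_jet_maps_def Cr_maps_scaleR lift_scaleR jet_scaleR[of r] Cr_maps_iff_Ck[symmetric])
qed

definition combination :: "(3 \<Rightarrow> 'b \<Rightarrow> 'c::real_vector) \<Rightarrow> real ^ 3 \<Rightarrow> 'b \<Rightarrow> 'c" where
  "combination \<Phi> p x = p $ 1 *\<^sub>R \<Phi> 1 x + p $ 2 *\<^sub>R \<Phi> 2 x + p $ 3 *\<^sub>R \<Phi> 3 x"

lemma combination_in_Lip_jet_maps: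
  assumes "\<And>l. \<Phi> l \<in> Lip_jet_maps r" "2 \<le> r"
  shows "combination \<Phi> p \<in> Lip_jet_maps r"
  unfolding combination_def using assms by (intro Lip_jet_maps_add Lip_jet_maps_scaleR)

lemma jet_combination:
  assumes "\<And>l. \<Phi> l \<in> Cr_maps r" "2 \<le> r"
  shows "jet (lift (combination \<Phi> p)) v = combination (\<lambda>l. jet (lift (\<Phi> l))) p v"
proof -
  have "Ck r (lift (\<Phi> l))" for l using assms by (simp add: Cr_maps_iff_Ck)
  then show ?thesis using assms(2) unfolding combination_def[abs_def]
    by (simp add: lift_add lift_scaleR jet_add[of r] jet_scaleR[of r] Ck_add Ck_scaleR)
qed

text \<open>The distance from \<open>g\<close> to \<open>\<lambda>x. 0 *\<^sub>R g x\<close>, the zero map, plays the role of the \<open>C\<^sup>r\<close> norm of \<open>g\<close>.\<close>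

lemma Cr_dist_add_scaleR_le:
  assumes "f \<in> Cr_maps r" "g \<in> Cr_maps r"
  shows "Cr_dist r f (\<lambda>x. f x + c *\<^sub>R g x) \<le> \<bar>c\<bar> * Cr_dist r g (\<lambda>x. 0 *\<^sub>R g x)"
proof (rule Cr_dist_le)
  fix js :: "2 list" and v assume js: "length js \<le> r"
  have Ck: "Ck r (lift f)" "Ck r (lift g)" using assms by (auto simp: Cr_maps_iff_Ck)
  have "norm (partials js (lift g) v - partials js (lift (\<lambda>x. 0 *\<^sub>R g x)) v) \<le> Cr_dist r g (\<lambda>x. 0 *\<^sub>R g x)"
    using assms js by (intro Cr_dist_upper Cr_maps_scaleR)
  then have "norm (partials js (lift g) v) \<le> Cr_dist r g (\<lambda>x. 0 *\<^sub>R g x)"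
    unfolding lift_scaleR partials_scaleR[OF Ck(2) js] by simp
  then have "norm (c *\<^sub>R partials js (lift g) v) \<le> \<bar>c\<bar> * Cr_dist r g (\<lambda>x. 0 *\<^sub>R g x)"
    by (simp add: mult_left_mono)
  then show "norm (partials js (lift f) v - partials js (lift (\<lambda>x. f x + c *\<^sub>R g x)) v) \<le>
      \<bar>c\<bar> * Cr_dist r g (\<lambda>x. 0 *\<^sub>R g x)"
    unfolding lift_add lift_scaleR partials_add[OF Ck(1) Ck_scaleR[OF Ck(2)] js] partials_scaleR[OF Ck(2) js]
    by simp
qed (use assms in \<open>auto intro!: Cr_maps_add Cr_maps_scaleR\<close>)

lemma Cr_dist_combination_le:
  assumes f: "f \<in> Cr_maps r" and \<Phi>: "\<And>l. \<Phi> l \<in> Cr_maps r"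
  shows "Cr_dist r f (\<lambda>x. f x + combination \<Phi> p x) \<le>
     norm p * (\<Sum>l\<in>UNIV. Cr_dist r (\<Phi> l) (\<lambda>x. 0 *\<^sub>R \<Phi> l x))"
proof -
  let ?B = "\<lambda>l. Cr_dist r (\<Phi> l) (\<lambda>x. 0 *\<^sub>R \<Phi> l x)"
  define f1 where "f1 = (\<lambda>x. f x + p $ 1 *\<^sub>R \<Phi> 1 x)"
  define f2 where "f2 = (\<lambda>x. f1 x + p $ 2 *\<^sub>R \<Phi> 2 x)"
  define f3 where "f3 = (\<lambda>x. f2 x + p $ 3 *\<^sub>R \<Phi> 3 x)"
  have C: "f1 \<in> Cr_maps r" "f2 \<in> Cr_maps r" "f3 \<in> Cr_maps r"
    unfolding f1_def f2_def f3_def by (intro Cr_maps_add Cr_maps_scaleR f \<Phi>)+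
  have step: "\<bar>p $ l\<bar> * ?B l \<le> norm p * ?B l" for l
    by (intro mult_right_mono component_le_norm_cart Metric_space.nonneg[OF Metric_space_Cr])
  have "Cr_dist r f f3 \<le> (Cr_dist r f f1 + Cr_dist r f1 f2) + Cr_dist r f2 f3"
    using Metric_space.triangle[OF Metric_space_Cr f C(2,3)] Metric_space.triangle[OF Metric_space_Cr f C(1,2)]
    by simp
  also have "\<dots> \<le> (norm p * ?B 1 + norm p * ?B 2) + norm p * ?B 3"
    using order_trans[OF Cr_dist_add_scaleR_le[OF f \<Phi>] step, of 1, folded f1_def]
      order_trans[OF Cr_dist_add_scaleR_le[OF C(1) \<Phi>] step, of 2, folded f2_def]
      order_trans[OF Cr_dist_add_scaleR_le[OF C(2) \<Phi>] step, of 3, folded f3_def] by linarith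
  finally show ?thesis
    by (simp add: f3_def f2_def f1_def combination_def sum_3 algebra_simps)
qed

lemma local_perturbation:
  fixes n :: "jet \<Rightarrow> real ^ 3" and M :: "jet \<Rightarrow> jet \<Rightarrow> real ^ 3" and \<Phi> :: "3 \<Rightarrow> torus \<Rightarrow> real ^ 2"
  assumes f0: "f0 \<in> Cr_maps r" and r: "2 \<le> r" and \<Phi>: "\<And>l. \<Phi> l \<in> Lip_jet_maps r"
    and n_lip: "\<And>R. \<exists>L. L-lipschitz_on (cball 0 R) n"
    and affine: "\<And>j p q x. n (j + combination (\<lambda>l. jet (lift (\<Phi> l))) p x) -
      n (j + combination (\<lambda>l. jet (lift (\<Phi> l))) q x) = M j (combination (\<lambda>l. jet (lift (\<Phi> l))) (p - q) x)"
    and M: "\<And>j. linear (M j)" "continuous_on UNIV (\<lambda>(j, k). M j k)"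
    and nondeg: "\<And>p. p \<noteq> 0 \<Longrightarrow> M (jet (lift f0) x0) (combination (\<lambda>l. jet (lift (\<Phi> l))) p x0) \<noteq> 0"
  shows "\<exists>\<rho>>0. \<exists>\<delta>>0. \<forall>f\<in>Lip_jet_maps r. Cr_dist r f0 f < \<delta> \<longrightarrow>
    (\<forall>\<eta>>0. \<exists>g\<in>Lip_jet_maps r. Cr_dist r f g < \<eta> \<and> (\<forall>y\<in>cball x0 \<rho>. n (jet (lift g) y) \<noteq> 0))"
proof -
  have M_compose: "continuous_on S (\<lambda>x. M (u x) (w x))"
    if "continuous_on S u" "continuous_on S w" for S :: "'z::topological_space set" and u w
    using continuous_on_compose2[OF M(2) continuous_on_Pair[OF that]] by simp
  define k where "k p x = combination (\<lambda>l. jet (lift (\<Phi> l))) p x" for p x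
  define j0 where "j0 = jet (lift f0) x0"
  define T where "T z p = M (fst z) (k p (snd z))" for z p
  have \<Phi>C: "\<Phi> l \<in> Cr_maps r" for l using \<Phi> by (simp add: Lip_jet_maps_def)
  have contk: "continuous_on UNIV (jet (lift (\<Phi> l)))" for l
    using \<Phi>C r by (intro continuous_jet[of r]) (simp_all add: Cr_maps_iff_Ck)
  have k_scale: "k (a *\<^sub>R p) x = a *\<^sub>R k p x" for a p x
    by (simp add: k_def combination_def scaleR_add_right)
  let ?S = "sphere 0 1 :: (real ^ 3) set"
  have contT: "continuous_on UNIV (\<lambda>(z, p). T z p)"
    unfolding T_def k_def combination_def case_prod_unfold
    by (intro M_compose continuous_intros continuous_on_compose2[OF contk]) auto
  have "continuous_on ?S (T (j0, x0))"
    unfolding T_def k_def combination_def by (intro M_compose continuous_intros)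
  then have "compact ((\<lambda>p. norm (T (j0, x0) p)) ` ?S)"
    by (intro compact_continuous_image compact_sphere continuous_on_norm)
  moreover have "axis 1 1 \<in> ?S" by simp
  then have "?S \<noteq> {}" by blast
  ultimately obtain p0 where p0: "p0 \<in> ?S" "\<And>p. p \<in> ?S \<Longrightarrow> norm (T (j0, x0) p0) \<le> norm (T (j0, x0) p)"
    using compact_attains_inf[of "(\<lambda>p. norm (T (j0, x0) p)) ` ?S"] by blast
  define c where "c = norm (T (j0, x0) p0) / 2"
  have "p0 \<noteq> 0" using p0(1) by auto
  then have "c > 0" using nondeg[of p0] by (simp add: c_def T_def j0_def k_def)
  have "uniformly_continuous_on (cball (j0, x0) 1 \<times> ?S) (\<lambda>(z, p). T z p)"
    by (intro compact_uniformly_continuous compact_Times compact_cball compact_sphere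
        continuous_on_subset[OF contT]) auto
  from this[unfolded uniformly_continuous_on_def case_prod_unfold, THEN spec, THEN mp, OF \<open>c > 0\<close>]
  obtain d where d: "d > 0"
    "\<forall>u\<in>cball (j0, x0) 1 \<times> ?S. \<forall>w\<in>cball (j0, x0) 1 \<times> ?S. dist w u < d \<longrightarrow>
      dist (T (fst w) (snd w)) (T (fst u) (snd u)) < c"
    by (elim exE conjE)
  have lower1: "c \<le> norm (T z p)" if "dist z (j0, x0) < min d 1" "p \<in> ?S" for z p
  proof -
    have "dist (T z p) (T (j0, x0) p) < c"
      using d(2)[THEN bspec, of "((j0, x0), p)", THEN bspec, of "(z, p)"] that
      by (simp add: dist_commute dist_Pair_Pair)
    moreover have "2 * c \<le> norm (T (j0, x0) p)" using p0 that by (simp add: c_def)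
    ultimately show ?thesis
      using norm_triangle_ineq2[of "T (j0, x0) p" "T z p"] by (simp add: dist_norm norm_minus_commute)
  qed
  have lower: "c * norm p \<le> norm (T z p)" if z: "dist z (j0, x0) < min d 1" for z p
  proof (cases "p = 0")
    case False
    have "T z p = norm p *\<^sub>R T z (p /\<^sub>R norm p)"
      using False by (simp add: T_def k_scale linear_scale[OF M(1)])
    moreover have "c \<le> norm (T z (p /\<^sub>R norm p))" using False by (intro lower1[OF z]) simp
    ultimately show ?thesis by (simp add: mult_left_mono mult.commute[of c])
  qed simp
  have "continuous (at x0) (jet (lift f0))"
    using continuous_jet[of r "lift f0"] f0 r
    by (simp add: Cr_maps_iff_Ck continuous_on_eq_continuous_at)
  then obtain \<rho>0 where \<rho>0: "\<rho>0 > 0" "\<And>y. dist y x0 < \<rho>0 \<Longrightarrow> dist (jet (lift f0) y) j0 < min d 1 / 3"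
    using d(1) unfolding continuous_at_eps_delta j0_def
    by (metis divide_pos_pos min_less_iff_conj zero_less_numeral zero_less_one)
  define \<rho> where "\<rho> = min \<rho>0 (min d 1 / 3) / 2"
  define \<delta> where "\<delta> = min d 1 / 18"
  have pos: "\<rho> > 0" "\<delta> > 0" using d(1) \<rho>0(1) by (auto simp: \<rho>_def \<delta>_def)
  show ?thesis
  proof (intro exI conjI ballI impI allI)
    fix f \<eta> assume f: "f \<in> Lip_jet_maps r" and close: "Cr_dist r f0 f < \<delta>" and \<eta>: "(\<eta> :: real) > 0"
    have fC: "f \<in> Cr_maps r" using f by (simp add: Lip_jet_maps_def)
    define B where "B = 1 + (\<Sum>l\<in>UNIV. Cr_dist r (\<Phi> l) (\<lambda>x. 0 *\<^sub>R \<Phi> l x))"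
    have "B > 0" unfolding B_def
      by (intro add_pos_nonneg sum_nonneg Metric_space.nonneg[OF Metric_space_Cr]) simp
    define H where "H x p = n (jet (lift f) x + k p x)" for x p
    have near: "dist (jet (lift f) x, x) (j0, x0) < min d 1" if "x \<in> cball x0 \<rho>" for x
    proof -
      have x: "dist x x0 \<le> \<rho>" using that by (simp add: dist_commute)
      have "dist (jet (lift f0) x) (jet (lift f) x) \<le> 6 * Cr_dist r f0 f" by (rule dist_jet_le[OF f0 fC r])
      then have "dist (jet (lift f) x) (jet (lift f0) x) < min d 1 / 3" using close by (simp add: \<delta>_def dist_commute)
      moreover have "dist (jet (lift f0) x) j0 < min d 1 / 3"
        using x pos \<rho>0(1) by (intro \<rho>0(2)) (auto simp: \<rho>_def)
      moreover have "dist x x0 < min d 1 / 3" using x pos d(1) \<rho>0(1) by (auto simp: \<rho>_def)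
      moreover have "dist (jet (lift f) x, x) (j0, x0) \<le> dist (jet (lift f) x) j0 + dist x x0"
        using norm_Pair_le[of "jet (lift f) x - j0" "x - x0"] by (simp add: dist_norm)
      ultimately show ?thesis using dist_triangle[of "jet (lift f) x" j0 "jet (lift f0) x"] by linarith
    qed
    have expand: "c * norm (p - q) \<le> norm (H x p - H x q)" if "x \<in> cball x0 \<rho>" for x p q
      using lower[OF near[OF that], of "p - q"] by (simp add: H_def k_def affine T_def)
    obtain L0 where L0: "L0-lipschitz_on UNIV (jet (lift f))" using f by (auto simp: Lip_jet_maps_def)
    have "\<exists>L. L-lipschitz_on UNIV (jet (lift (\<Phi> l)))" for l using \<Phi> by (auto simp: Lip_jet_maps_def)
    then obtain L where L: "\<And>l. (L l)-lipschitz_on UNIV (jet (lift (\<Phi> l)))" by metis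
    have bdd: "\<exists>R. \<forall>x\<in>cball x0 \<rho>. norm (F x) \<le> R" if "continuous_on UNIV F" for F :: "real ^ 2 \<Rightarrow> jet"
      using compact_imp_bounded[OF compact_continuous_image[OF continuous_on_subset[OF that] compact_cball, of x0 \<rho>]]
      by (auto simp: bounded_iff)
    have "\<exists>R. \<forall>x\<in>cball x0 \<rho>. norm (jet (lift f) x) \<le> R"
      using fC r by (intro bdd continuous_jet[of r]) (auto simp: Cr_maps_iff_Ck)
    then obtain R0 where R0: "\<And>x. x \<in> cball x0 \<rho> \<Longrightarrow> norm (jet (lift f) x) \<le> R0" by blast
    have "\<exists>R. \<forall>x\<in>cball x0 \<rho>. norm (jet (lift (\<Phi> l)) x) \<le> R" for l
      by (intro bdd contk)
    then obtain R where R: "\<And>l x. x \<in> cball x0 \<rho> \<Longrightarrow> norm (jet (lift (\<Phi> l)) x) \<le> R l"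
      by metis
    have coef: "norm (p $ l *\<^sub>R y) \<le> b" if "norm p \<le> 1" "norm y \<le> b" for p :: "real ^ 3" and l and y :: jet and b
      using mult_mono[of "\<bar>p $ l\<bar>" 1 "norm y" b] component_le_norm_cart[of p l] that by simp
    let ?R = "R0 + (R 1 + R 2 + R 3)" and ?L = "L0 + (L 1 + L 2 + L 3)"
    have bd: "jet (lift f) x + k p x \<in> cball 0 ?R" if x: "x \<in> cball x0 \<rho>" and p: "norm p \<le> 1" for x p
      unfolding mem_cball_0 k_def combination_def
      by (intro norm_triangle_le add_mono R0 R coef x p)
    have diff: "norm ((jet (lift f) x + k p x) - (jet (lift f) y + k p y)) \<le> ?L * norm (x - y)"
      if p: "norm p \<le> 1" for x y p
    proof -
      have "(jet (lift f) x + k p x) - (jet (lift f) y + k p y) =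
        (jet (lift f) x - jet (lift f) y) + (p $ 1 *\<^sub>R (jet (lift (\<Phi> 1)) x - jet (lift (\<Phi> 1)) y)
          + p $ 2 *\<^sub>R (jet (lift (\<Phi> 2)) x - jet (lift (\<Phi> 2)) y) + p $ 3 *\<^sub>R (jet (lift (\<Phi> 3)) x - jet (lift (\<Phi> 3)) y))"
        by (simp add: k_def combination_def algebra_simps)
      also have "norm \<dots> \<le> L0 * norm (x - y) + (L 1 * norm (x - y) + L 2 * norm (x - y) + L 3 * norm (x - y))"
        by (intro norm_triangle_le add_mono coef p lipschitz_onD[OF L0, unfolded dist_norm]
              lipschitz_onD[OF L, unfolded dist_norm] UNIV_I)
      finally show ?thesis by (simp add: algebra_simps)
    qed
    obtain Ln where Ln: "Ln-lipschitz_on (cball 0 ?R) n" using n_lip by blast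
    have lips: "norm (H x p - H y p) \<le> (Ln * ?L) * norm (x - y)"
      if "x \<in> cball x0 \<rho>" "y \<in> cball x0 \<rho>" "norm p \<le> 1" for x y p
    proof -
      have "norm (H x p - H y p) \<le> Ln * norm ((jet (lift f) x + k p x) - (jet (lift f) y + k p y))"
        unfolding H_def using lipschitz_onD[OF Ln bd bd] that by (simp add: dist_norm)
      also have "\<dots> \<le> Ln * (?L * norm (x - y))"
        by (intro mult_left_mono diff that lipschitz_on_nonneg[OF Ln])
      finally show ?thesis by (simp add: mult.assoc)
    qed
    have "\<eta> / B > 0" using \<eta> \<open>B > 0\<close> by simp
    obtain p where p: "norm p < \<eta> / B" "\<And>x. x \<in> cball x0 \<rho> \<Longrightarrow> H x p \<noteq> 0"
      by (rule exists_small_parameter_avoiding_zeros[OF \<open>c > 0\<close> \<open>\<eta> / B > 0\<close>,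
            where H = H and K = "cball x0 \<rho>" and C = "Ln * ?L"])
        (erule expand | erule (2) lips | blast)+
    define g where "g = (\<lambda>x. f x + combination \<Phi> p x)"
    have comb: "combination \<Phi> p \<in> Lip_jet_maps r" by (rule combination_in_Lip_jet_maps[OF \<Phi> r])
    have "g \<in> Lip_jet_maps r" unfolding g_def by (rule Lip_jet_maps_add[OF f comb r])
    moreover have "Cr_dist r f g < \<eta>"
    proof -
      have "Cr_dist r f g \<le> norm p * (B - 1)"
        unfolding g_def B_def using Cr_dist_combination_le[OF fC \<Phi>C] by simp
      also have "\<dots> \<le> norm p * B" by (intro mult_left_mono) auto
      also have "\<dots> < \<eta>" using p(1) \<open>B > 0\<close> by (simp add: pos_less_divide_eq)
      finally show ?thesis .
    qed
    moreover have "jet (lift g) y = jet (lift f) y + k p y" for y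
    proof -
      have "Ck r (lift f)" "Ck r (lift (combination \<Phi> p))"
        using fC comb by (auto simp: Lip_jet_maps_def Cr_maps_iff_Ck)
      then show ?thesis using r
        by (simp add: g_def lift_add jet_add[of r] jet_combination[OF \<Phi>C] k_def)
    qed
    ultimately show "\<exists>g\<in>Lip_jet_maps r. Cr_dist r f g < \<eta> \<and> (\<forall>y\<in>cball x0 \<rho>. n (jet (lift g) y) \<noteq> 0)"
      using p(2) by (auto simp: H_def)
  qed (use pos in auto)
qed

lemma jet_condition_open:
  assumes n: "continuous_on UNIV n" and f: "f \<in> Cr_maps r" and r: "2 \<le> r" and K: "compact K"
    and nz: "\<And>y. y \<in> K \<Longrightarrow> n (jet (lift f) y) \<noteq> (0::real ^ 3)"
  shows "\<exists>\<delta>>0. \<forall>g\<in>Cr_maps r. Cr_dist r f g < \<delta> \<longrightarrow> (\<forall>y\<in>K. n (jet (lift g) y) \<noteq> 0)"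
proof -
  let ?J = "jet (lift f) ` K"
  have "compact ?J"
    by (intro compact_continuous_image K continuous_on_subset[OF continuous_jet[of r]])
       (use f r in \<open>auto simp: Cr_maps_iff_Ck\<close>)
  moreover have "closed {j. n j = 0}"
    using continuous_closed_preimage_constant[of UNIV n 0] n by simp
  moreover have "?J \<inter> {j. n j = 0} = {}" using nz by auto
  ultimately have "\<exists>d>0. \<forall>a\<in>?J. \<forall>b\<in>{j. n j = 0}. d \<le> dist a b"
    by (rule separate_compact_closed)
  then obtain d where d: "d > 0" "\<forall>a\<in>?J. \<forall>b\<in>{j. n j = 0}. d \<le> dist a b"
    by (elim exE conjE)
  show ?thesis
  proof (intro exI conjI ballI impI notI)
    show "d / 6 > 0" using d by simp
    fix g y assume g: "g \<in> Cr_maps r" "Cr_dist r f g < d / 6" and y: "y \<in> K"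
      and zero: "n (jet (lift g) y) = 0"
    have "dist (jet (lift f) y) (jet (lift g) y) \<le> 6 * Cr_dist r f g"
      by (rule dist_jet_le[OF f g(1) r])
    moreover have "d \<le> dist (jet (lift f) y) (jet (lift g) y)" using d(2) y zero by blast
    ultimately show False using g(2) by linarith
  qed
qed

lemma local_to_global_perturbation:
  assumes f0: "f0 \<in> Lip_jet_maps r" and r: "2 \<le> r" and \<Omega>: "compact \<Omega>" and "\<eta> > 0"
    and n: "continuous_on UNIV (n :: jet \<Rightarrow> real ^ 3)"
    and loc: "\<And>x. x \<in> \<Omega> \<Longrightarrow> \<exists>\<rho>>0. \<exists>\<delta>>0. \<forall>f\<in>Lip_jet_maps r. Cr_dist r f0 f < \<delta> \<longrightarrow>
      (\<forall>\<eta>>0. \<exists>g\<in>Lip_jet_maps r. Cr_dist r f g < \<eta> \<and> (\<forall>y\<in>cball x \<rho>. n (jet (lift g) y) \<noteq> 0))"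
  obtains g where "g \<in> Lip_jet_maps r" "Cr_dist r f0 g < \<eta>" "\<And>y. y \<in> \<Omega> \<Longrightarrow> n (jet (lift g) y) \<noteq> 0"
proof -
  obtain \<rho> \<delta> where \<rho>: "\<And>x. x \<in> \<Omega> \<Longrightarrow> \<rho> x > 0" and \<delta>: "\<And>x. x \<in> \<Omega> \<Longrightarrow> \<delta> x > 0"
    and step: "\<And>x f \<eta>. x \<in> \<Omega> \<Longrightarrow> f \<in> Lip_jet_maps r \<Longrightarrow> Cr_dist r f0 f < \<delta> x \<Longrightarrow> \<eta> > 0 \<Longrightarrow>
      \<exists>g\<in>Lip_jet_maps r. Cr_dist r f g < \<eta> \<and> (\<forall>y\<in>cball x (\<rho> x). n (jet (lift g) y) \<noteq> 0)"
    using loc by metis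
  have C: "f \<in> Cr_maps r" if "f \<in> Lip_jet_maps r" for f using that by (simp add: Lip_jet_maps_def)
  have "\<exists>g\<in>Lip_jet_maps r. Cr_dist r f0 g < \<eta> \<and> (\<forall>x\<in>X. \<forall>y\<in>cball x (\<rho> x). n (jet (lift g) y) \<noteq> 0)"
    if "finite X" "X \<subseteq> \<Omega>" "\<eta> > 0" for X \<eta>
    using that
  proof (induction X arbitrary: \<eta> rule: finite_induct)
    case empty
    then show ?case using f0 Metric_space.mdist_zero[OF Metric_space_Cr C[OF f0]]
      by (intro bexI[of _ f0]) auto
  next
    case (insert x X)
    then have x: "x \<in> \<Omega>" and X: "X \<subseteq> \<Omega>" by auto
    have "0 < min (\<eta> / 2) (\<delta> x)" using insert.prems \<delta>[OF x] by simp
    from insert.IH[OF X this] obtain f where f: "f \<in> Lip_jet_maps r" "Cr_dist r f0 f < \<eta> / 2"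
      "Cr_dist r f0 f < \<delta> x" "\<forall>x\<in>X. \<forall>y\<in>cball x (\<rho> x). n (jet (lift f) y) \<noteq> 0"
      unfolding min_less_iff_conj by blast
    have cpt: "compact (\<Union>x\<in>X. cball x (\<rho> x))" using insert.hyps by (intro compact_UN) auto
    have "\<exists>d>0. \<forall>g\<in>Cr_maps r. Cr_dist r f g < d \<longrightarrow>
        (\<forall>y\<in>(\<Union>x\<in>X. cball x (\<rho> x)). n (jet (lift g) y) \<noteq> 0)"
      by (rule jet_condition_open[OF n C[OF f(1)] r cpt]) (use f(4) in blast)
    then obtain d where d: "d > 0" "\<forall>g\<in>Cr_maps r. Cr_dist r f g < d \<longrightarrow>
        (\<forall>y\<in>(\<Union>x\<in>X. cball x (\<rho> x)). n (jet (lift g) y) \<noteq> 0)"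
      by (elim exE conjE)
    have "0 < min d (\<eta> / 2)" using d insert.prems by simp
    from step[OF x f(1,3) this] obtain g where g: "g \<in> Lip_jet_maps r" "Cr_dist r f g < d"
      "Cr_dist r f g < \<eta> / 2" "\<forall>y\<in>cball x (\<rho> x). n (jet (lift g) y) \<noteq> 0"
      unfolding min_less_iff_conj by blast
    have "Cr_dist r f0 g \<le> Cr_dist r f0 f + Cr_dist r f g"
      by (rule Metric_space.triangle[OF Metric_space_Cr C[OF f0] C[OF f(1)] C[OF g(1)]])
    with f(2) g(3) have "Cr_dist r f0 g < \<eta>" by simp
    moreover have "\<forall>x\<in>X. \<forall>y\<in>cball x (\<rho> x). n (jet (lift g) y) \<noteq> 0"
      using d(2)[rule_format, OF C[OF g(1)] g(2)] by blast
    ultimately show ?case using g(1,4) by blast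
  qed
  note fin = this
  have cover: "\<Omega> \<subseteq> (\<Union>x\<in>\<Omega>. ball x (\<rho> x))"
  proof
    fix y assume "y \<in> \<Omega>"
    then show "y \<in> (\<Union>x\<in>\<Omega>. ball x (\<rho> x))" using \<rho> by (intro UN_I[of y]) simp_all
  qed
  obtain X where X: "X \<subseteq> \<Omega>" "finite X" "\<Omega> \<subseteq> (\<Union>x\<in>X. ball x (\<rho> x))"
    by (rule compactE_image[OF \<Omega> open_ball cover])
  from fin[OF X(2,1) \<open>\<eta> > 0\<close>] obtain g where g: "g \<in> Lip_jet_maps r" "Cr_dist r f0 g < \<eta>"
    "\<And>x y. x \<in> X \<Longrightarrow> y \<in> cball x (\<rho> x) \<Longrightarrow> n (jet (lift g) y) \<noteq> 0" by blast
  have "n (jet (lift g) y) \<noteq> 0" if "y \<in> \<Omega>" for y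
  proof -
    have "y \<in> (\<Union>x\<in>X. ball x (\<rho> x))" using X(3) that by (rule subsetD)
    then obtain x where "x \<in> X" "y \<in> ball x (\<rho> x)" by (rule UN_E)
    then show ?thesis by (intro g(3)[of x]) simp_all
  qed
  with g(1,2) show ?thesis by (rule that)
qed

section \<open>Trigonometric perturbations with prescribed jets\<close>

definition component_jet :: "2 \<Rightarrow> real ^ 2 \<Rightarrow> real ^ 2 ^ 2 \<Rightarrow> jet" where
  "component_jet c P Q = (\<chi> i. P $ i *\<^sub>R axis c 1, \<chi> i k. Q $ i $ k *\<^sub>R axis c 1)"

lemma component_jet_add: "component_jet c P Q + component_jet c P' Q' = component_jet c (P + P') (Q + Q')"
  by (simp add: component_jet_def vec_eq_iff algebra_simps)

lemma component_jet_scaleR: "s *\<^sub>R component_jet c P Q = component_jet c (s *\<^sub>R P) (s *\<^sub>R Q)"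
  by (simp add: component_jet_def vec_eq_iff)

definition component_maps :: "nat \<Rightarrow> 2 \<Rightarrow> (torus \<Rightarrow> real ^ 2) set" where
  "component_maps r c = {\<phi> \<in> Lip_jet_maps r. \<forall>v. \<exists>P Q. jet (lift \<phi>) v = component_jet c P Q}"

lemma jet_lift_add:
  assumes "f \<in> Lip_jet_maps r" "g \<in> Lip_jet_maps r" "2 \<le> r"
  shows "jet (lift (\<lambda>x. f x + g x)) v = jet (lift f) v + jet (lift g) v"
  using assms by (simp add: lift_add jet_add[of r] Lip_jet_maps_def Cr_maps_iff_Ck)

lemma jet_lift_scaleR:
  assumes "f \<in> Lip_jet_maps r" "2 \<le> r"
  shows "jet (lift (\<lambda>x. s *\<^sub>R f x)) v = s *\<^sub>R jet (lift f) v"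
  using assms by (simp add: lift_scaleR jet_scaleR[of r] Lip_jet_maps_def Cr_maps_iff_Ck)

lemma component_maps_add:
  assumes "f \<in> component_maps r c" "g \<in> component_maps r c" "2 \<le> r"
  shows "(\<lambda>x. f x + g x) \<in> component_maps r c"
proof -
  have "\<exists>P Q. jet (lift f) v + jet (lift g) v = component_jet c P Q" for v
    using assms(1,2) by (auto simp: component_maps_def) (metis component_jet_add)
  with assms show ?thesis by (auto simp: component_maps_def Lip_jet_maps_add jet_lift_add)
qed

lemma component_maps_scaleR:
  assumes "f \<in> component_maps r c" "2 \<le> r"
  shows "(\<lambda>x. s *\<^sub>R f x) \<in> component_maps r c"
proof -
  have "\<exists>P Q. s *\<^sub>R jet (lift f) v = component_jet c P Q" for v
    using assms(1) by (auto simp: component_maps_def) (metis component_jet_scaleR)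
  with assms show ?thesis by (auto simp: component_maps_def Lip_jet_maps_scaleR jet_lift_scaleR)
qed

lemma jet_wave:
  "jet (\<lambda>v. sin (a \<bullet> v + b) *\<^sub>R axis c 1) v =
    cos (a \<bullet> v + b) *\<^sub>R component_jet c a 0 - sin (a \<bullet> v + b) *\<^sub>R component_jet c 0 (\<chi> i k. a $ i * a $ k)"
proof -
  have "sin (a \<bullet> v + (b + pi / 2)) = cos (a \<bullet> v + b)"
    using sin_cos_eq[of "a \<bullet> v + (b + pi / 2)"] by (simp add: sin_add add.assoc[symmetric])
  moreover have "sin (a \<bullet> v + (b + pi)) = - sin (a \<bullet> v + b)"
    by (simp add: add.assoc[symmetric])
  ultimately show ?thesis
    unfolding jet_def partials_wave component_jet_def
    by (simp add: vec_eq_iff inner_axis cart_eq_inner_axis[symmetric] inner_commute)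
qed

lemma abs_sin_diff_le: "\<bar>sin x - sin y\<bar> \<le> \<bar>x - y\<bar>" for x y :: real
proof -
  have "\<bar>sin x - sin y\<bar> = 2 * (\<bar>sin ((x - y) / 2)\<bar> * \<bar>cos ((x + y) / 2)\<bar>)"
    by (simp add: sin_diff_sin abs_mult)
  also have "\<dots> \<le> 2 * (\<bar>(x - y) / 2\<bar> * 1)"
    by (intro mult_left_mono mult_mono abs_sin_x_le_abs_x abs_cos_le_one) auto
  finally show ?thesis by simp
qed

lemma wave_in_component_maps:
  fixes b :: real and c :: 2
  assumes k: "\<And>i. k $ i \<in> \<int>"
  defines "F \<equiv> \<lambda>v. sin (((2 * pi) *\<^sub>R k) \<bullet> v + b) *\<^sub>R axis c 1"
  shows "F \<circ> rep \<in> component_maps r c" "lift (F \<circ> rep) = F"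
proof -
  let ?a = "(2 * pi) *\<^sub>R k"
  let ?P = "component_jet c ?a 0" and ?Q = "component_jet c 0 (\<chi> i k. ?a $ i * ?a $ k)"
  show lF: "lift (F \<circ> rep) = F"
    unfolding F_def by (rule lift_comp_rep[OF periodic_wave[OF k]])
  have jet: "jet F v = cos (?a \<bullet> v + b) *\<^sub>R ?P - sin (?a \<bullet> v + b) *\<^sub>R ?Q" for v
    unfolding F_def by (rule jet_wave)
  have "norm (jet F v - jet F w) \<le> (norm ?a * (norm ?P + norm ?Q)) * norm (v - w)" for v w
  proof -
    have s: "\<bar>(?a \<bullet> v + t) - (?a \<bullet> w + t)\<bar> \<le> norm ?a * norm (v - w)" for t
      using Cauchy_Schwarz_ineq2[of ?a "v - w"] by (simp only: inner_diff_right add_diff_add diff_self add_0_right)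
    have c: "\<bar>cos (?a \<bullet> v + b) - cos (?a \<bullet> w + b)\<bar> \<le> norm ?a * norm (v - w)"
      using order_trans[OF abs_sin_diff_le s, of "b + pi / 2"]
      by (simp only: add.assoc[symmetric] sin_add sin_pi_half cos_pi_half mult_zero_right mult_1_right add_0_left)
    have "jet F v - jet F w = (cos (?a \<bullet> v + b) - cos (?a \<bullet> w + b)) *\<^sub>R ?P -
        (sin (?a \<bullet> v + b) - sin (?a \<bullet> w + b)) *\<^sub>R ?Q"
      unfolding jet scaleR_diff_left by simp
    also have "norm \<dots> \<le> norm ((cos (?a \<bullet> v + b) - cos (?a \<bullet> w + b)) *\<^sub>R ?P) +
        norm ((sin (?a \<bullet> v + b) - sin (?a \<bullet> w + b)) *\<^sub>R ?Q)"
      by (rule norm_triangle_ineq4)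
    also have "\<dots> \<le> (norm ?a * norm (v - w)) * norm ?P + (norm ?a * norm (v - w)) * norm ?Q"
      unfolding norm_scaleR[of "_ - _"]
      by (intro add_mono mult_right_mono c order_trans[OF abs_sin_diff_le s] norm_ge_zero)
    also have "\<dots> = (norm ?a * (norm ?P + norm ?Q)) * norm (v - w)" by (simp only: distrib_left mult_ac)
    finally show ?thesis .
  qed
  then have "(norm ?a * (norm ?P + norm ?Q))-lipschitz_on UNIV (jet F)"
    unfolding lipschitz_on_def dist_norm by simp
  moreover have "Ck r F" unfolding F_def by (rule Ck_wave)
  moreover have "\<exists>P Q. jet F v = component_jet c P Q" for v
    unfolding jet component_jet_scaleR
    by (subst diff_conv_add_uminus, subst scaleR_minus1_left[symmetric])
       (metis component_jet_add component_jet_scaleR)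
  ultimately show "F \<circ> rep \<in> component_maps r c"
    unfolding component_maps_def Lip_jet_maps_def Cr_maps_iff_Ck mem_Collect_eq lF by blast
qed

lemma exists_component_map_with_jet:
  assumes r: "2 \<le> r" and sym: "H $ 1 $ 2 = H $ 2 $ 1"
  obtains \<phi> where "\<phi> \<in> component_maps r c" "jet (lift \<phi>) x = component_jet c g H"
proof -
  \<comment> \<open>At \<open>x\<close> the wave \<open>W k \<beta>\<close> has phase \<open>\<beta>\<close>: it has only a gradient for \<open>\<beta> = 0\<close> and only a Hessian for \<open>\<beta> = - \<pi> / 2\<close>.\<close>
  define W where "W k \<beta> = (\<lambda>v. sin (((2 * pi) *\<^sub>R k) \<bullet> v + (\<beta> - ((2 * pi) *\<^sub>R k) \<bullet> x)) *\<^sub>R (axis c 1 :: real ^ 2)) \<circ> rep"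
    for k \<beta>
  let ?I = "{k :: real ^ 2. \<forall>i. k $ i \<in> \<int>}"
  have W: "W k \<beta> \<in> component_maps r c" if "k \<in> ?I" for k \<beta>
    unfolding W_def using that by (intro wave_in_component_maps) auto
  have jW: "jet (lift (W k \<beta>)) x = cos \<beta> *\<^sub>R component_jet c ((2 * pi) *\<^sub>R k) 0
      - sin \<beta> *\<^sub>R component_jet c 0 (\<chi> i l. ((2 * pi) *\<^sub>R k) $ i * ((2 * pi) *\<^sub>R k) $ l)"
    if k: "k \<in> ?I" for k \<beta>
  proof -
    have "lift (W k \<beta>) = (\<lambda>v. sin (((2 * pi) *\<^sub>R k) \<bullet> v + (\<beta> - ((2 * pi) *\<^sub>R k) \<bullet> x)) *\<^sub>R axis c 1)"
      unfolding W_def using k by (intro wave_in_component_maps) auto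
    moreover have "((2 * pi) *\<^sub>R k) \<bullet> x + (\<beta> - ((2 * pi) *\<^sub>R k) \<bullet> x) = \<beta>" by simp
    ultimately show ?thesis by (simp only: jet_wave)
  qed
  define e1 e2 where "e1 = (axis 1 1 :: real ^ 2)" and "e2 = (axis 2 1 :: real ^ 2)"
  have e: "e1 \<in> ?I" "e2 \<in> ?I" "e1 + e2 \<in> ?I"
    by (auto simp: e1_def e2_def axis_def)
  define h where "h = H $ 1 $ 2"
  define \<phi> where "\<phi> = (\<lambda>y. (g $ 1 / (2 * pi)) *\<^sub>R W e1 0 y + ((g $ 2 / (2 * pi)) *\<^sub>R W e2 0 y +
    (((H $ 1 $ 1 - h) / (2 * pi)\<^sup>2) *\<^sub>R W e1 (- (pi / 2)) y + (((H $ 2 $ 2 - h) / (2 * pi)\<^sup>2) *\<^sub>R W e2 (- (pi / 2)) y +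
      (h / (2 * pi)\<^sup>2) *\<^sub>R W (e1 + e2) (- (pi / 2)) y))))"
  have "\<phi> \<in> component_maps r c"
    unfolding \<phi>_def by (intro component_maps_add component_maps_scaleR W e r)
  moreover have "jet (lift \<phi>) x = component_jet c g H"
  proof -
    have L: "W k \<beta> \<in> Lip_jet_maps r" if "k \<in> ?I" for k \<beta>
      using W[OF that] by (simp add: component_maps_def)
    have "jet (lift \<phi>) x = (g $ 1 / (2 * pi)) *\<^sub>R jet (lift (W e1 0)) x + ((g $ 2 / (2 * pi)) *\<^sub>R jet (lift (W e2 0)) x +
    (((H $ 1 $ 1 - h) / (2 * pi)\<^sup>2) *\<^sub>R jet (lift (W e1 (- (pi / 2)))) x + (((H $ 2 $ 2 - h) / (2 * pi)\<^sup>2) *\<^sub>R jet (lift (W e2 (- (pi / 2)))) x +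
      (h / (2 * pi)\<^sup>2) *\<^sub>R jet (lift (W (e1 + e2) (- (pi / 2)))) x)))"
      unfolding \<phi>_def
      by (simp only: jet_lift_add[of _ r] jet_lift_scaleR[of _ r] Lip_jet_maps_add Lip_jet_maps_scaleR L e r)
    also have "\<dots> = component_jet c g H"
      unfolding jW[OF e(1)] jW[OF e(2)] jW[OF e(3)]
      using sym
      by (simp add: component_jet_def e1_def e2_def axis_def vec_eq_iff forall_2 h_def power2_eq_square field_simps)
    finally show ?thesis .
  qed
  ultimately show ?thesis by (rule that)
qed

section \<open>The determinant and its gradient as a function of the jet\<close>

text \<open>Polarized: on the diagonal the three entries are \<open>det DF\<close> and its partial derivatives.\<close>

definition det_jet_form :: "jet \<Rightarrow> jet \<Rightarrow> real ^ 3" where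
  "det_jet_form j k = vector
     [fst j $ 1 $ 1 * fst k $ 2 $ 2 - fst j $ 2 $ 1 * fst k $ 1 $ 2,
      snd j $ 1 $ 1 $ 1 * fst k $ 2 $ 2 + fst j $ 1 $ 1 * snd k $ 1 $ 2 $ 2
        - snd j $ 1 $ 2 $ 1 * fst k $ 1 $ 2 - fst j $ 2 $ 1 * snd k $ 1 $ 1 $ 2,
      snd j $ 2 $ 1 $ 1 * fst k $ 2 $ 2 + fst j $ 1 $ 1 * snd k $ 2 $ 2 $ 2
        - snd j $ 2 $ 2 $ 1 * fst k $ 1 $ 2 - fst j $ 2 $ 1 * snd k $ 2 $ 1 $ 2]"

lemma bounded_bilinear_det_jet_form: "bounded_bilinear det_jet_form"
  unfolding bilinear_conv_bounded_bilinear[symmetric] bilinear_def linear_iff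
  by (simp add: det_jet_form_def vec_eq_iff forall_3 algebra_simps)

definition det_jet :: "jet \<Rightarrow> real ^ 3" where
  "det_jet j = det_jet_form j j"

lemma continuous_det_jet: "continuous_on UNIV det_jet"
  unfolding det_jet_def by (intro bounded_bilinear.continuous_on[OF bounded_bilinear_det_jet_form] continuous_intros)

lemma bounded_bilinear_diagonal_Lipschitz:
  assumes "bounded_bilinear \<beta>"
  shows "\<exists>L. L-lipschitz_on (cball 0 R) (\<lambda>j. \<beta> j j)"
proof -
  interpret \<beta>: bounded_bilinear \<beta> by (rule assms)
  obtain B where B: "B > 0" "\<And>j k. norm (\<beta> j k) \<le> norm j * norm k * B" using \<beta>.pos_bounded by blast
  have "norm (\<beta> j j - \<beta> k k) \<le> (2 * \<bar>R\<bar> * B) * norm (j - k)"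
    if "norm j \<le> R" "norm k \<le> R" for j k
  proof -
    have "\<beta> j j - \<beta> k k = \<beta> (j - k) j + \<beta> k (j - k)"
      by (simp add: \<beta>.diff_left \<beta>.diff_right)
    also have "norm \<dots> \<le> norm (j - k) * norm j * B + norm k * norm (j - k) * B"
      by (intro norm_triangle_le add_mono B)
    also have "\<dots> \<le> norm (j - k) * \<bar>R\<bar> * B + \<bar>R\<bar> * norm (j - k) * B"
      using that B(1) by (intro add_mono mult_right_mono mult_left_mono) auto
    finally show ?thesis by (simp add: algebra_simps)
  qed
  then have "(2 * \<bar>R\<bar> * B)-lipschitz_on (cball 0 R) (\<lambda>j. \<beta> j j)"
    using B(1) unfolding lipschitz_on_def dist_norm by simp
  then show ?thesis by blast
qed

definition det_jet_linearization :: "jet \<Rightarrow> jet \<Rightarrow> real ^ 3" where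
  "det_jet_linearization j k = det_jet_form j k + det_jet_form k j"

lemma det_jet_form_component_jet:
  "det_jet_form (component_jet c P Q) (component_jet c P' Q') = 0"
  using exhaust_2[of c] by (auto simp: det_jet_form_def component_jet_def axis_def vec_eq_iff forall_3)

lemma det_jet_affine:
  assumes "k = component_jet c P Q" "l = component_jet c P' Q'"
  shows "det_jet (j + k) - det_jet (j + l) = det_jet_linearization j (k - l)"
proof -
  interpret bounded_bilinear det_jet_form by (rule bounded_bilinear_det_jet_form)
  have "det_jet_form k k = 0" "det_jet_form l l = 0"
    by (simp_all add: assms det_jet_form_component_jet)
  then show ?thesis
    by (simp add: det_jet_def det_jet_linearization_def add_left add_right diff_left diff_right)
qed

text \<open>
  Perturbing component \<open>c\<close> by a function with gradient \<open>P\<close> and Hessian \<open>Q\<close> changes the determinant by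
  \<open>v \<bullet> P\<close>, and, if \<open>P = 0\<close>, its gradient by \<open>Q v\<close>. Here \<open>P = p\<^sub>1 v\<close> and \<open>Q = p\<^sub>2 v v\<^sup>T + p\<^sub>3 (v w\<^sup>T + w v\<^sup>T)\<close>
  where \<open>w\<close> is \<open>v\<close> rotated by a right angle, so that \<open>Q v = \<bar>v\<bar>\<^sup>2 (p\<^sub>2 v + p\<^sub>3 w)\<close>.
\<close>

lemma det_jet_linearization_nonzero:
  fixes p :: "real ^ 3"
  assumes v: "v = (if c = 1 then vector [fst j $ 2 $ 2, - (fst j $ 1 $ 2)] else vector [- (fst j $ 2 $ 1), fst j $ 1 $ 1])"
    and "v \<noteq> 0" and "p \<noteq> 0"
    and P: "P = p $ 1 *\<^sub>R v"
    and Q: "Q = vector [vector [p $ 2 * v $ 1 * v $ 1 - p $ 3 * (2 * v $ 1 * v $ 2), p $ 2 * v $ 1 * v $ 2 + p $ 3 * (v $ 1 * v $ 1 - v $ 2 * v $ 2)],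
      vector [p $ 2 * v $ 1 * v $ 2 + p $ 3 * (v $ 1 * v $ 1 - v $ 2 * v $ 2), p $ 2 * v $ 2 * v $ 2 + p $ 3 * (2 * v $ 1 * v $ 2)]]"
  shows "det_jet_linearization j (component_jet c P Q) \<noteq> (0 :: real ^ 3)"
proof
  assume zero: "det_jet_linearization j (component_jet c P Q) = 0"
  define a b h where "a = v $ 1" and "b = v $ 2" and "h = a * a + b * b"
  have "a \<noteq> 0 \<or> b \<noteq> 0" using \<open>v \<noteq> 0\<close> by (simp add: vec_eq_iff forall_2 a_def b_def)
  then have h: "h \<noteq> 0" by (simp add: h_def sum_squares_eq_zero_iff)
  have c: "c = 1 \<or> c = 2" using exhaust_2 .
  have "det_jet_linearization j (component_jet c P Q) $ 1 = p $ 1 * h"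
    using c by (elim disjE) (simp_all add: det_jet_linearization_def det_jet_form_def component_jet_def axis_def P v a_def b_def h_def algebra_simps)
  with zero h have p1: "p $ 1 = 0" by simp
  have "det_jet_linearization j (component_jet c P Q) $ 2 = Q $ 1 $ 1 * a + Q $ 1 $ 2 * b"
    using c by (elim disjE) (simp_all add: det_jet_linearization_def det_jet_form_def component_jet_def axis_def P p1 v a_def b_def)
  with zero have "Q $ 1 $ 1 * a + Q $ 1 $ 2 * b = 0" by simp
  moreover have "Q $ 1 $ 1 * a + Q $ 1 $ 2 * b = (p $ 2 * a - p $ 3 * b) * h"
    by (simp add: Q a_def[symmetric] b_def[symmetric] h_def algebra_simps)
  ultimately have eq1: "p $ 2 * a - p $ 3 * b = 0" using h by simp
  have "det_jet_linearization j (component_jet c P Q) $ 3 = Q $ 2 $ 1 * a + Q $ 2 $ 2 * b"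
    using c by (elim disjE) (simp_all add: det_jet_linearization_def det_jet_form_def component_jet_def axis_def P p1 v a_def b_def)
  with zero have "Q $ 2 $ 1 * a + Q $ 2 $ 2 * b = 0" by simp
  moreover have "Q $ 2 $ 1 * a + Q $ 2 $ 2 * b = (p $ 2 * b + p $ 3 * a) * h"
    by (simp add: Q a_def[symmetric] b_def[symmetric] h_def algebra_simps)
  ultimately have eq2: "p $ 2 * b + p $ 3 * a = 0" using h by simp
  have "p $ 2 * h = (p $ 2 * a - p $ 3 * b) * a + (p $ 2 * b + p $ 3 * a) * b"
    by (simp add: h_def algebra_simps)
  with eq1 eq2 h have p2: "p $ 2 = 0" by simp
  have "p $ 3 * h = (p $ 2 * b + p $ 3 * a) * a - (p $ 2 * a - p $ 3 * b) * b"
    by (simp add: h_def algebra_simps)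
  with eq1 eq2 h have "p $ 3 = 0" by simp
  with p1 p2 \<open>p \<noteq> 0\<close> show False by (simp add: vec_eq_iff forall_3)
qed

section \<open>Genericity\<close>

lemma combination_diff: "combination \<Phi> p x - combination \<Phi> q x = combination \<Phi> (p - q) x"
  by (simp add: combination_def algebra_simps)

definition jacobian_entries :: "jet \<Rightarrow> real ^ 3" where
  "jacobian_entries j = vector [fst j $ 1 $ 1, fst j $ 2 $ 1, fst j $ 1 $ 2]"

lemma linear_jacobian_entries: "linear jacobian_entries"
  by (simp add: linear_iff jacobian_entries_def vec_eq_iff forall_3)

lemma generic_nonzero_jacobian:
  assumes f: "f \<in> Lip_jet_maps r" and r: "2 \<le> r" and "\<eta> > 0" and \<Omega>: "compact \<Omega>"
  obtains g where "g \<in> Lip_jet_maps r" "Cr_dist r f g < \<eta>"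
    "\<And>y. y \<in> \<Omega> \<Longrightarrow> fst (jet (lift g) y) \<noteq> 0"
proof -
  have bl: "bounded_linear jacobian_entries"
    using linear_jacobian_entries linear_conv_bounded_linear by blast
  have cont: "continuous_on UNIV jacobian_entries"
    by (intro linear_continuous_on bl)
  have loc: "\<exists>\<rho>>0. \<exists>\<delta>>0. \<forall>g\<in>Lip_jet_maps r. Cr_dist r f g < \<delta> \<longrightarrow>
      (\<forall>\<eta>>0. \<exists>h\<in>Lip_jet_maps r. Cr_dist r g h < \<eta> \<and>
        (\<forall>y\<in>cball x \<rho>. jacobian_entries (jet (lift h) y) \<noteq> 0))" for x
  proof -
    obtain \<phi>1 where \<phi>1: "\<phi>1 \<in> component_maps r 1" "jet (lift \<phi>1) x = component_jet 1 (axis 1 1) 0"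
      by (rule exists_component_map_with_jet[OF r, of 0]) auto
    obtain \<phi>2 where \<phi>2: "\<phi>2 \<in> component_maps r 1" "jet (lift \<phi>2) x = component_jet 1 (axis 2 1) 0"
      by (rule exists_component_map_with_jet[OF r, of 0]) auto
    obtain \<phi>3 where \<phi>3: "\<phi>3 \<in> component_maps r 2" "jet (lift \<phi>3) x = component_jet 2 (axis 1 1) 0"
      by (rule exists_component_map_with_jet[OF r, of 0]) auto
    define \<Phi> :: "3 \<Rightarrow> torus \<Rightarrow> real ^ 2" where "\<Phi> l = (if l = 1 then \<phi>1 else if l = 2 then \<phi>2 else \<phi>3)" for l
    have \<Phi>: "\<Phi> 1 = \<phi>1" "\<Phi> 2 = \<phi>2" "\<Phi> 3 = \<phi>3" by (simp_all add: \<Phi>_def)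
    show ?thesis
    proof (rule local_perturbation[where \<Phi> = \<Phi> and M = "\<lambda>_. jacobian_entries"])
      show "f \<in> Cr_maps r" using f by (simp add: Lip_jet_maps_def)
      show "\<Phi> l \<in> Lip_jet_maps r" for l
        using \<phi>1 \<phi>2 \<phi>3 by (simp add: \<Phi>_def component_maps_def)
      show "\<exists>L. L-lipschitz_on (cball 0 R) jacobian_entries" for R
        using bounded_linear.lipschitz_boundE[OF bl] by blast
      show "jacobian_entries (j + combination (\<lambda>l. jet (lift (\<Phi> l))) p y) -
          jacobian_entries (j + combination (\<lambda>l. jet (lift (\<Phi> l))) q y) =
          jacobian_entries (combination (\<lambda>l. jet (lift (\<Phi> l))) (p - q) y)" for j p q y
        unfolding combination_diff[symmetric]
        by (simp add: linear_add[OF linear_jacobian_entries] linear_diff[OF linear_jacobian_entries])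
      show "continuous_on UNIV (\<lambda>(j :: jet, k). jacobian_entries k)"
        unfolding case_prod_unfold
        by (rule continuous_on_compose2[OF cont continuous_on_snd]) (auto intro: continuous_on_id)
      show "jacobian_entries (combination (\<lambda>l. jet (lift (\<Phi> l))) p x) \<noteq> 0" if "p \<noteq> 0" for p
      proof -
        have "jacobian_entries (combination (\<lambda>l. jet (lift (\<Phi> l))) p x) = p"
          unfolding combination_def \<Phi> \<phi>1 \<phi>2 \<phi>3
          by (simp add: jacobian_entries_def component_jet_def axis_def vec_eq_iff forall_3)
        with that show ?thesis by simp
      qed
    qed (rule r linear_jacobian_entries)+
  qed
  obtain g where g: "g \<in> Lip_jet_maps r" "Cr_dist r f g < \<eta>"
      "\<And>y. y \<in> \<Omega> \<Longrightarrow> jacobian_entries (jet (lift g) y) \<noteq> 0"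
    by (rule local_to_global_perturbation[OF f r \<Omega> \<open>\<eta> > 0\<close> cont loc]) (rule that)
  have "fst (jet (lift g) y) \<noteq> 0" if "y \<in> \<Omega>" for y
    using g(3)[OF that] by (auto simp: jacobian_entries_def vec_eq_iff forall_3)
  with g(1,2) show ?thesis by (rule that)
qed

lemma linear_det_jet_linearization: "linear (det_jet_linearization j)"
proof -
  interpret bounded_bilinear det_jet_form by (rule bounded_bilinear_det_jet_form)
  show ?thesis
    by (simp add: linear_iff det_jet_linearization_def add_left add_right scaleR_left scaleR_right scaleR_add_right)
qed

lemma continuous_det_jet_linearization: "continuous_on UNIV (\<lambda>(j, k). det_jet_linearization j k)"
  unfolding det_jet_linearization_def case_prod_unfold
  by (intro continuous_on_add bounded_bilinear.continuous_on[OF bounded_bilinear_det_jet_form]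
        continuous_on_fst continuous_on_snd continuous_on_id)

lemma generic_nonzero_det_jet:
  assumes f: "f \<in> Lip_jet_maps r" and r: "2 \<le> r" and "\<eta> > 0" and \<Omega>: "compact \<Omega>"
    and nz: "\<And>y. y \<in> \<Omega> \<Longrightarrow> fst (jet (lift f) y) \<noteq> 0"
  obtains g where "g \<in> Lip_jet_maps r" "Cr_dist r f g < \<eta>"
    "\<And>y. y \<in> \<Omega> \<Longrightarrow> det_jet (jet (lift g) y) \<noteq> 0"
proof -
  have loc: "\<exists>\<rho>>0. \<exists>\<delta>>0. \<forall>g\<in>Lip_jet_maps r. Cr_dist r f g < \<delta> \<longrightarrow>
      (\<forall>\<eta>>0. \<exists>h\<in>Lip_jet_maps r. Cr_dist r g h < \<eta> \<and>
        (\<forall>y\<in>cball x \<rho>. det_jet (jet (lift h) y) \<noteq> 0))" if "x \<in> \<Omega>" for x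
  proof -
    define j where "j = jet (lift f) x"
    define w :: "2 \<Rightarrow> real ^ 2" where "w c = (if c = 1 then vector [fst j $ 2 $ 2, - (fst j $ 1 $ 2)]
      else vector [- (fst j $ 2 $ 1), fst j $ 1 $ 1])" for c
    have "w 1 \<noteq> 0 \<or> w 2 \<noteq> 0"
      using nz[OF that] by (auto simp: w_def j_def vec_eq_iff forall_2)
    then obtain c where c: "w c \<noteq> 0" by blast
    define v where "v = w c"
    let ?H2 = "vector [vector [v $ 1 * v $ 1, v $ 1 * v $ 2], vector [v $ 1 * v $ 2, v $ 2 * v $ 2]] :: real ^ 2 ^ 2"
    let ?H3 = "vector [vector [- (2 * v $ 1 * v $ 2), v $ 1 * v $ 1 - v $ 2 * v $ 2],
      vector [v $ 1 * v $ 1 - v $ 2 * v $ 2, 2 * v $ 1 * v $ 2]] :: real ^ 2 ^ 2"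
    obtain \<phi>1 where \<phi>1: "\<phi>1 \<in> component_maps r c" "jet (lift \<phi>1) x = component_jet c v 0"
      by (rule exists_component_map_with_jet[OF r, of 0]) auto
    obtain \<phi>2 where \<phi>2: "\<phi>2 \<in> component_maps r c" "jet (lift \<phi>2) x = component_jet c 0 ?H2"
      by (rule exists_component_map_with_jet[OF r, of ?H2]) auto
    obtain \<phi>3 where \<phi>3: "\<phi>3 \<in> component_maps r c" "jet (lift \<phi>3) x = component_jet c 0 ?H3"
      by (rule exists_component_map_with_jet[OF r, of ?H3]) auto
    define \<Phi> :: "3 \<Rightarrow> torus \<Rightarrow> real ^ 2" where "\<Phi> l = (if l = 1 then \<phi>1 else if l = 2 then \<phi>2 else \<phi>3)" for l
    have \<Phi>: "\<Phi> 1 = \<phi>1" "\<Phi> 2 = \<phi>2" "\<Phi> 3 = \<phi>3" by (simp_all add: \<Phi>_def)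
    have \<Phi>c: "\<Phi> l \<in> component_maps r c" for l using \<phi>1 \<phi>2 \<phi>3 by (simp add: \<Phi>_def)
    have \<Phi>L: "\<Phi> l \<in> Lip_jet_maps r" for l using \<Phi>c by (simp add: component_maps_def)
    have comb: "\<exists>P Q. combination (\<lambda>l. jet (lift (\<Phi> l))) p y = component_jet c P Q" for p y
    proof -
      have "combination \<Phi> p \<in> component_maps r c"
        unfolding combination_def by (intro component_maps_add component_maps_scaleR \<Phi>c r)
      then have "\<exists>P Q. jet (lift (combination \<Phi> p)) y = component_jet c P Q"
        by (simp add: component_maps_def)
      moreover have "jet (lift (combination \<Phi> p)) y = combination (\<lambda>l. jet (lift (\<Phi> l))) p y"
        using \<Phi>L by (intro jet_combination[of _ r]) (auto simp: Lip_jet_maps_def r)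
      ultimately show ?thesis by simp
    qed
    show ?thesis
    proof (rule local_perturbation[where \<Phi> = \<Phi> and M = det_jet_linearization])
      show "f \<in> Cr_maps r" using f by (simp add: Lip_jet_maps_def)
      show "\<exists>L. L-lipschitz_on (cball 0 R) det_jet" for R
        unfolding det_jet_def[abs_def]
        by (rule bounded_bilinear_diagonal_Lipschitz[OF bounded_bilinear_det_jet_form])
      show "det_jet (j + combination (\<lambda>l. jet (lift (\<Phi> l))) p y) -
          det_jet (j + combination (\<lambda>l. jet (lift (\<Phi> l))) q y) =
          det_jet_linearization j (combination (\<lambda>l. jet (lift (\<Phi> l))) (p - q) y)" for j p q y
      proof -
        obtain P Q P' Q' where "combination (\<lambda>l. jet (lift (\<Phi> l))) p y = component_jet c P Q"
          "combination (\<lambda>l. jet (lift (\<Phi> l))) q y = component_jet c P' Q'"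
          using comb by metis
        from det_jet_affine[OF this] show ?thesis by (simp only: combination_diff)
      qed
      show "det_jet_linearization (jet (lift f) x) (combination (\<lambda>l. jet (lift (\<Phi> l))) p x) \<noteq> 0"
        if "p \<noteq> 0" for p
      proof -
        have "combination (\<lambda>l. jet (lift (\<Phi> l))) p x = component_jet c (p $ 1 *\<^sub>R v)
          (p $ 2 *\<^sub>R ?H2 + p $ 3 *\<^sub>R ?H3)"
          unfolding combination_def \<Phi> \<phi>1 \<phi>2 \<phi>3 component_jet_scaleR component_jet_add by simp
        moreover have "det_jet_linearization (jet (lift f) x) (component_jet c (p $ 1 *\<^sub>R v)
          (p $ 2 *\<^sub>R ?H2 + p $ 3 *\<^sub>R ?H3)) \<noteq> 0"
          by (rule det_jet_linearization_nonzero[OF _ _ that refl, of v])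
             (use c in \<open>simp_all add: v_def[symmetric], simp_all add: v_def w_def j_def vec_eq_iff forall_2\<close>)
        ultimately show ?thesis by simp
      qed
    qed (rule r \<Phi>L linear_det_jet_linearization continuous_det_jet_linearization)+
  qed
  show ?thesis
    by (rule local_to_global_perturbation[OF f r \<Omega> \<open>\<eta> > 0\<close> continuous_det_jet loc]) (assumption, rule that)
qed

lemma tjacobian_proj: "tjacobian f (proj v) $ i $ k = fst (jet (lift f) v) $ k $ i"
  by (simp add: tjacobian_def tderiv_proj matrix_def jet_def partial_def)

lemma det_tjacobian_proj: "det (tjacobian f (proj v)) = det_jet (jet (lift f) v) $ 1"
  by (simp add: det_2 tjacobian_proj det_jet_def det_jet_form_def algebra_simps)

lemma det_tjacobian_has_derivative:
  assumes f: "f \<in> Cr_maps r" and r: "2 \<le> r"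
  obtains D where "(lift (\<lambda>y. det (tjacobian f y)) has_derivative D) (at v)"
    "D (axis 1 1) = det_jet (jet (lift f) v) $ 2" "D (axis 2 1) = det_jet (jet (lift f) v) $ 3"
proof -
  let ?P = "\<lambda>i. partials [i] (lift f)"
  define E where "E i = frechet_derivative (?P i) (at v)" for i
  have E: "(?P i has_derivative E i) (at v)" for i
  proof -
    have "?P i differentiable (at v)" using f r by (simp add: Cr_maps_def del: partials_Cons)
    then show ?thesis by (simp add: E_def frechet_derivative_works del: partials_Cons)
  qed
  have Ec: "((\<lambda>v. ?P i v $ k) has_derivative (\<lambda>h. E i h $ k)) (at v)" for i k
    by (rule bounded_linear.has_derivative[OF bounded_linear_vec_nth E])
  have entry: "E i (axis k 1) = snd (jet (lift f) v) $ k $ i" for i k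
    by (simp add: E_def jet_def partial_def)
  have eq: "lift (\<lambda>y. det (tjacobian f y)) = (\<lambda>v. ?P 1 v $ 1 * ?P 2 v $ 2 - ?P 2 v $ 1 * ?P 1 v $ 2)"
  proof
    fix v
    have "lift (\<lambda>y. det (tjacobian f y)) v = det (tjacobian f (proj v))" by (simp add: lift_def)
    then show "lift (\<lambda>y. det (tjacobian f y)) v = ?P 1 v $ 1 * ?P 2 v $ 2 - ?P 2 v $ 1 * ?P 1 v $ 2"
      by (simp add: det_tjacobian_proj det_jet_def det_jet_form_def jet_def del: partials_Cons)
  qed
  show ?thesis
  proof (rule that)
    show "(lift (\<lambda>y. det (tjacobian f y)) has_derivative
        (\<lambda>h. (?P 1 v $ 1 * E 2 h $ 2 + E 1 h $ 1 * ?P 2 v $ 2) - (?P 2 v $ 1 * E 1 h $ 2 + E 2 h $ 1 * ?P 1 v $ 2))) (at v)"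
      unfolding eq by (intro has_derivative_diff has_derivative_mult Ec)
  qed (simp_all only: entry, simp_all add: det_jet_def det_jet_form_def jet_def)
qed

lemma periodic_jet_lift: "periodic (jet (lift f))"
  unfolding periodic_def jet_def by (simp add: partials_periodic del: partials_Cons)

lemma jet_lift_unit_square:
  obtains w where "w \<in> cbox 0 1" "jet (lift f) v = jet (lift f) w"
proof -
  define a :: "real ^ 2" where "a = (\<chi> i. - of_int \<lfloor>v $ i\<rfloor>)"
  have "(v + a) $ i = frac (v $ i)" for i by (simp add: a_def frac_def)
  then have "v + a \<in> cbox 0 1" by (simp add: mem_box_cart less_imp_le frac_lt_1)
  moreover have "jet (lift f) v = jet (lift f) (v + a)"
    using periodic_jet_lift[of f] by (simp add: periodic_def a_def)
  ultimately show ?thesis by (rule that)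
qed

definition nondegenerate_maps :: "nat \<Rightarrow> (torus \<Rightarrow> real ^ 2) set" where
  "nondegenerate_maps r = {f \<in> Cr_maps r. \<forall>v. det_jet (jet (lift f) v) \<noteq> 0}"

lemma nondegenerate_mapsI:
  assumes "f \<in> Cr_maps r" "\<And>v. v \<in> cbox 0 1 \<Longrightarrow> det_jet (jet (lift f) v) \<noteq> 0"
  shows "f \<in> nondegenerate_maps r"
proof -
  have "det_jet (jet (lift f) v) \<noteq> 0" for v
  proof -
    obtain w where "w \<in> cbox 0 1" "jet (lift f) v = jet (lift f) w" by (rule jet_lift_unit_square)
    then show ?thesis using assms(2) by simp
  qed
  with assms(1) show ?thesis by (simp add: nondegenerate_maps_def)
qed

lemma openin_nondegenerate_maps:
  assumes r: "2 \<le> r" shows "openin (Cr_topology r) (nondegenerate_maps r)"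
  unfolding Cr_topology_def Metric_space.openin_mtopology[OF Metric_space_Cr]
proof (intro conjI allI impI)
  show "nondegenerate_maps r \<subseteq> Cr_maps r" by (auto simp: nondegenerate_maps_def)
  fix f assume f: "f \<in> nondegenerate_maps r"
  then have fC: "f \<in> Cr_maps r" by (simp add: nondegenerate_maps_def)
  have "\<exists>\<delta>>0. \<forall>g\<in>Cr_maps r. Cr_dist r f g < \<delta> \<longrightarrow> (\<forall>y\<in>cbox 0 1. det_jet (jet (lift g) y) \<noteq> 0)"
    using f by (intro jet_condition_open continuous_det_jet fC r compact_cbox) (simp add: nondegenerate_maps_def)
  then obtain \<delta> where \<delta>: "\<delta> > 0" "\<And>g. g \<in> Cr_maps r \<Longrightarrow> Cr_dist r f g < \<delta> \<Longrightarrow> g \<in> nondegenerate_maps r"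
    by (meson nondegenerate_mapsI)
  then show "\<exists>\<delta>>0. Metric_space.mball (Cr_maps r) (Cr_dist r) f \<delta> \<subseteq> nondegenerate_maps r"
    by (intro exI[of _ \<delta>]) (auto simp: Metric_space.in_mball[OF Metric_space_Cr])
qed

lemma nondegenerate_maps_approximation:
  assumes r: "2 \<le> r" and f: "f \<in> Cr_maps r" and "\<eta> > 0"
  obtains g where "g \<in> nondegenerate_maps r" "Cr_dist r f g < \<eta>"
proof -
  have \<eta>: "\<eta> / 3 > 0" using \<open>\<eta> > 0\<close> by simp
  obtain f1 where f1: "f1 \<in> Lip_jet_maps r" "Cr_dist r f f1 < \<eta> / 3"
    by (rule Lip_jet_maps_dense[OF f \<eta> r])
  obtain f2 where f2: "f2 \<in> Lip_jet_maps r" "Cr_dist r f1 f2 < \<eta> / 3"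
    "\<And>y. y \<in> cbox 0 1 \<Longrightarrow> fst (jet (lift f2) y) \<noteq> 0"
    by (rule generic_nonzero_jacobian[OF f1(1) r \<eta> compact_cbox[of 0 1]]) (rule that)
  obtain g where g: "g \<in> Lip_jet_maps r" "Cr_dist r f2 g < \<eta> / 3"
    "\<And>y. y \<in> cbox 0 1 \<Longrightarrow> det_jet (jet (lift g) y) \<noteq> 0"
    by (rule generic_nonzero_det_jet[OF f2(1) r \<eta> compact_cbox f2(3)]) (assumption, rule that)
  have C: "f1 \<in> Cr_maps r" "f2 \<in> Cr_maps r" "g \<in> Cr_maps r"
    using f1(1) f2(1) g(1) by (simp_all add: Lip_jet_maps_def)
  have "Cr_dist r f g < \<eta>"
    using Metric_space.triangle[OF Metric_space_Cr f C(1,3)]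
      Metric_space.triangle[OF Metric_space_Cr C(1,2,3)] f1(2) f2(2) g(2) by simp
  with nondegenerate_mapsI[OF C(3) g(3)] show ?thesis by (rule that)
qed

lemma residual_nondegenerate_maps:
  assumes r: "2 \<le> r" shows "residual_in (Cr_topology r) (nondegenerate_maps r)"
proof -
  have "Cr_topology r closure_of nondegenerate_maps r = Cr_maps r"
  proof (rule antisym)
    show "Cr_topology r closure_of nondegenerate_maps r \<subseteq> Cr_maps r"
      using closure_of_subset_topspace by (metis topspace_Cr_topology)
    show "Cr_maps r \<subseteq> Cr_topology r closure_of nondegenerate_maps r"
      unfolding Cr_topology_def Metric_space.metric_closure_of[OF Metric_space_Cr]
    proof (intro subsetI CollectI conjI allI impI)
      fix f :: "torus \<Rightarrow> real ^ 2" and \<eta> :: real assume f: "f \<in> Cr_maps r" and \<eta>: "\<eta> > 0"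
      obtain g where g: "g \<in> nondegenerate_maps r" "Cr_dist r f g < \<eta>"
        by (rule nondegenerate_maps_approximation[OF r f \<eta>])
      then show "\<exists>g\<in>nondegenerate_maps r. g \<in> Metric_space.mball (Cr_maps r) (Cr_dist r) f \<eta>"
        using f by (intro bexI[of _ g]) (auto simp: Metric_space.in_mball[OF Metric_space_Cr] nondegenerate_maps_def)
    qed
  qed
  moreover have "nondegenerate_maps r \<subseteq> Cr_maps r" by (auto simp: nondegenerate_maps_def)
  ultimately show ?thesis
    unfolding residual_in_def topspace_Cr_topology
    by (intro conjI exI[of _ "\<lambda>_. nondegenerate_maps r"]) (simp_all add: openin_nondegenerate_maps[OF r])
qed

lemma nondegenerate_maps_regular:
  assumes r: "2 \<le> r" and f: "f \<in> nondegenerate_maps r" and det0: "det (tjacobian f x) = 0"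
  shows "surj (tderiv (\<lambda>y. det (tjacobian f y)) x)"
proof -
  let ?g = "\<lambda>y. det (tjacobian f y)" and ?j = "jet (lift f) (rep x)"
  have fC: "f \<in> Cr_maps r" and nz: "det_jet ?j \<noteq> 0" using f by (auto simp: nondegenerate_maps_def)
  obtain D where D: "(lift ?g has_derivative D) (at (rep x))"
    "D (axis 1 1) = det_jet ?j $ 2" "D (axis 2 1) = det_jet ?j $ 3"
    by (rule det_tjacobian_has_derivative[OF fC r])
  have "tderiv ?g x = D" unfolding tderiv_def using frechet_derivative_at[OF D(1)] by simp
  moreover have "D (axis 1 1) \<noteq> 0 \<or> D (axis 2 1) \<noteq> 0"
    using nz det0 det_tjacobian_proj[of f "rep x"] by (simp add: D vec_eq_iff forall_3)
  then obtain i where i: "D (axis i 1) \<noteq> 0" by blast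
  have "linear D" using D(1) by (rule has_derivative_linear)
  then have "surj D"
    using i by (intro surjI[of D "\<lambda>c. (c / D (axis i 1)) *\<^sub>R axis i 1"]) (simp add: linear_scale)
  ultimately show ?thesis by simp
qed

theorem proposition26:
  fixes r :: nat
  assumes "r \<ge> 2"
  shows "\<exists>R. residual_in (Cr_topology r) R \<and>
    (\<forall>\<psi>\<in>R.
      {x. det (tjacobian \<psi> x) = 0} \<inter>
        {x. tderiv (\<lambda>y. det (tjacobian \<psi> y)) x = (\<lambda>v. 0)} = {} \<and>
      regular_value (\<lambda>x. det (tjacobian \<psi> x)) 0)"
proof (intro exI conjI ballI)
  show "residual_in (Cr_topology r) (nondegenerate_maps r)"
    by (rule residual_nondegenerate_maps[OF assms])
  fix \<psi> assume \<psi>: "\<psi> \<in> nondegenerate_maps r"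
  note surj = nondegenerate_maps_regular[OF assms \<psi>]
  show "regular_value (\<lambda>x. det (tjacobian \<psi> x)) 0"
    unfolding regular_value_def using surj by blast
  have not_surj: "\<not> surj (\<lambda>v :: real ^ 2. 0 :: real)"
    by (auto simp: surj_def intro: exI[of _ 1])
  show "{x. det (tjacobian \<psi> x) = 0} \<inter>
      {x. tderiv (\<lambda>y. det (tjacobian \<psi> y)) x = (\<lambda>v. 0)} = {}"
  proof (rule equals0I)
    fix x assume "x \<in> {x. det (tjacobian \<psi> x) = 0} \<inter> {x. tderiv (\<lambda>y. det (tjacobian \<psi> y)) x = (\<lambda>v. 0)}"
    then have "det (tjacobian \<psi> x) = 0" "tderiv (\<lambda>y. det (tjacobian \<psi> y)) x = (\<lambda>v. 0)" by simp_all
    with surj[of x] not_surj show False by simp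
  qed
qed

end
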